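(* Let $k\ge3$ be odd, let $W_a$ be the affine Weyl group of type $\widetilde A_{k-1}$ acting on $\mathbb{R}^k$, with fundamental alcove $\mathcal A=\{y\in\mathbb{R}^k:1+y_k>y_1>\cdots>y_k\}$, and let $f(y_1,\dots,y_k)=f_1(y_1)\cdots f_k(y_k)$ for integrable functions $f_i:\mathbb{R}\to\mathbb{R}$. If for all $i\neq j$ $$\sum_{m=1}^\infty\int_{y-z\in(-\infty,-m)\cup(m,\infty)}|f_i(y)f_j(z)|\,dy\,dz<\infty,$$ then $$\int_{\mathcal A}\sum_{\omega\in W_a}\varepsilon(\omega)f(\omega y)\,dy=\sum_{l=1}^k(-1)^{l+1}\left(\int_{\mathbb{R}}f_l\right)\mathrm{Pf}(H_{ij})_{i,j\in[k]\setminus\{l\}},$$ where $$H_{ij}=\int_{\mathbb{R}^2}\mathrm{sgn}(y-z)f_i(y)f_j(z)\,dy\,dz+2\sum_{m=1}^\infty\int_{y-z\in(-\infty,-m)\cup(m,\infty)}\mathrm{sgn}(y-z)f_i(y)f_j(z)\,dy\,dz .$$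
   Context: $[k]=\{1,\dots,k\}$. $W_a$ is the group of affine maps of $\mathbb{R}^k$ of the form $\omega(y)=w(y)+d$, with $w\in\mathfrak S_k$ permuting the canonical basis vectors and $d\in L=\{d\in\mathbb{Z}^k:\sum_id_i=0\}$; $\varepsilon(\omega)=\det w$ is the signature of the permutation. $\mathrm{Pf}$ denotes the Pfaffian: $\mathrm{Pf}(a_{ij})=\sum_\pi(-1)^{c(\pi)}\prod_{\{i<j\}\in\pi}a_{ij}$, summed over partitions $\pi$ of the (ordered) index set into pairs, $c(\pi)$ being the number of crossings (pairs of blocks $\{i<j\},\{i'<j'\}$ with $i<i'<j<j'$). The entries $H_{ij}$ ($i\ne j$) are skew-symmetric, and $H_{ii}=0$. *)

theory Defs
  imports "HOL-Analysis.Analysis"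
begin

text \<open>The index set \<open>[k] = {1,...,k}\<close> is a finite linearly ordered type \<open>'k\<close> with
  \<open>CARD('k) = k\<close>: there \<open>1\<close> is \<open>Min UNIV\<close>, \<open>k\<close> is \<open>Max UNIV\<close>, and the number of an
  index is its position in the order.\<close>

definition index_pos :: "'k::{finite,linorder} \<Rightarrow> nat" where
  "index_pos l = card {..l}"

definition alcove :: "(real ^ 'k::{finite,linorder}) set" where
  "alcove = {y. (\<forall>i j. i < j \<longrightarrow> y $ i > y $ j) \<and> 1 + y $ Max UNIV > y $ Min UNIV}"

text \<open>The linear map sending each basis vector \<open>e\<^sub>i\<close> to \<open>e\<^sub>p\<^sub>(\<^sub>i\<^sub>)\<close>.\<close>

definition perm_map :: "('k::finite \<Rightarrow> 'k) \<Rightarrow> real ^ 'k \<Rightarrow> real ^ 'k" where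
  "perm_map p y = (\<Sum>i\<in>UNIV. (y $ i) *\<^sub>R axis (p i) 1)"

definition zero_sum_lattice :: "(real ^ 'k::finite) set" where
  "zero_sum_lattice = {d. (\<forall>i. d $ i \<in> \<int>) \<and> (\<Sum>i\<in>UNIV. d $ i) = 0}"

definition affine_weyl_group :: "(real ^ 'k::finite \<Rightarrow> real ^ 'k) set" where
  "affine_weyl_group =
     {\<omega>. \<exists>p d. p permutes UNIV \<and> d \<in> zero_sum_lattice \<and> \<omega> = (\<lambda>y. perm_map p y + d)}"

text \<open>For an affine map \<open>\<omega>\<close>, the map \<open>y \<mapsto> \<omega> y - \<omega> 0\<close> is its linear part \<open>w\<close>.\<close>

definition weyl_sign :: "(real ^ 'k::finite \<Rightarrow> real ^ 'k) \<Rightarrow> real" where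
  "weyl_sign \<omega> = det (matrix (\<lambda>y. \<omega> y - \<omega> 0))"

definition pair_partitions :: "'a set \<Rightarrow> 'a set set set" where
  "pair_partitions I = {\<pi>. partition_on I \<pi> \<and> (\<forall>B\<in>\<pi>. card B = 2)}"

definition crossings :: "'a::linorder set set \<Rightarrow> nat" where
  "crossings \<pi> = card {(B, B'). B \<in> \<pi> \<and> B' \<in> \<pi> \<and>
     Min B < Min B' \<and> Min B' < Max B \<and> Max B < Max B'}"

definition pfaffian :: "'a::linorder set \<Rightarrow> ('a \<Rightarrow> 'a \<Rightarrow> real) \<Rightarrow> real" where
  "pfaffian I a =
     (\<Sum>\<pi>\<in>pair_partitions I. (-1) ^ crossings \<pi> * (\<Prod>B\<in>\<pi>. a (Min B) (Max B)))"

definition far_apart :: "nat \<Rightarrow> (real \<times> real) set" where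
  "far_apart m = {(y, z). y - z \<in> {..< - real m} \<union> {real m <..}}"

text \<open>The series over \<open>m \<ge> 1\<close> is indexed by \<open>Suc m\<close>.\<close>

definition H_entry :: "(real \<Rightarrow> real) \<Rightarrow> (real \<Rightarrow> real) \<Rightarrow> real" where
  "H_entry g h =
     (LINT (y, z)|lebesgue. sgn (y - z) * g y * h z) +
     2 * (\<Sum>m. LINT (y, z):far_apart (Suc m)|lebesgue. sgn (y - z) * g y * h z)"

end

theory Submission imports Defs begin

text \<open>The alcoves \<open>\<omega>(A)\<close> tile the space up to a null set, so the left-hand side is the integral of
  \<open>\<epsilon>(y) f(y)\<close> over \<open>\<real>\<^sup>k\<close>, where \<open>\<epsilon>\<close> takes the value \<open>\<epsilon>(\<omega>)\<close> on \<open>\<omega>(A)\<close>. Let \<open>h(x) = 2\<lfloor>x\<rfloor> + 1\<close>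
  for non-integral \<open>x\<close> and border the skew-symmetric matrix \<open>h(y\<^sub>i - y\<^sub>j)\<close> by a row of ones. As \<open>k\<close> is odd,
  the bordered matrix has even size. Its Pfaffian is alternating in \<open>y\<close>; replacing \<open>y\<^sub>i\<close> by \<open>y\<^sub>i + n\<close> adds
  \<open>2n\<close> times the border to row \<open>i\<close> and so does not change it; and on \<open>A\<close> all entries above the diagonal
  are \<open>1\<close>, which makes it \<open>1\<close>. Hence it equals \<open>\<epsilon>(y)\<close>. Expanding it along the border and then over pair
  partitions, each summand is a product of functions of disjoint pairs of coordinates, and Fubini's
  theorem turns it into a product of entries \<open>H\<^sub>i\<^sub>j\<close>, because
  \<open>h(x) = sgn x (1 + 2 \<Sum>\<^sub>m 1[\<bar>x\<bar> > m])\<close>.\<close>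

section \<open>Pfaffians along lists\<close>

text \<open>Odd \<open>k\<close> also enters through symmetry. The map y -> (1 + y_k, y_1, ...,
  y_(k-1)) preserves A and combines a k-cycle with an integer translation. An alternating function
  invariant under all of Z^k can be nonzero on A only if this cycle is even. The step 2 of h is
  chosen so that a unit translation adds a multiple of a constant row, which the border can absorb.
  Pfaffians are treated as functions of lists because the exchange and shift arguments need
  arbitrary orders and repeated entries, while the Pfaffian of the statement belongs to a set with a
  fixed order. The whole sum is almost everywhere plus or minus the product of the f_i, but its
  individual summands contain the unbounded h. Integrating term by term is what the hypothesis on
  the f_i pays for: off the integers |h(x)| is 1 plus twice the number of m >= 1 with m < |x|. The
  f_i are only Lebesgue measurable, whereas product measures and image measures live on
  \<open>lborel\<close>. Borel representatives bridge this, and their exceptional null sets have to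
  be carried to pairs, to R^k and through every \<omega>.\<close>

definition remove_nth :: "nat \<Rightarrow> 'a list \<Rightarrow> 'a list" where
  "remove_nth i xs = take i xs @ drop (Suc i) xs"

lemma length_remove_nth [simp]: "i < length xs \<Longrightarrow> length (remove_nth i xs) = length xs - 1"
  by (auto simp: remove_nth_def)

lemma map_remove_nth: "map g (remove_nth i xs) = remove_nth i (map g xs)"
  by (simp add: remove_nth_def take_map drop_map)

lemma nth_remove_nth: "i < length xs \<Longrightarrow> j < length xs - 1 \<Longrightarrow> remove_nth i xs ! j = xs ! (if j < i then j else Suc j)"
  by (auto simp: remove_nth_def nth_append min_def)

lemma remove_nth_append_left: "i < length us \<Longrightarrow> remove_nth i (us @ vs) = remove_nth i us @ vs"
  by (simp add: remove_nth_def)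

lemma remove_nth_append_right: "remove_nth (length us + i) (us @ vs) = us @ remove_nth i vs"
  by (simp add: remove_nth_def)

lemma remove_nth_0 [simp]: "remove_nth 0 (x # xs) = xs"
  and remove_nth_Suc [simp]: "remove_nth (Suc i) (x # xs) = x # remove_nth i xs"
  by (simp_all add: remove_nth_def)

text \<open>Expansion along the first row, in the order in which the list presents its entries. Only
  values \<open>a u v\<close> with \<open>u\<close> before \<open>v\<close> are read, and entries
  may repeat, so exchanges, shifts and the border are all edits of the list.\<close>

function list_pfaffian :: "('a \<Rightarrow> 'a \<Rightarrow> real) \<Rightarrow> 'a list \<Rightarrow> real" where
  "list_pfaffian a [] = 1"
| "list_pfaffian a (x # xs) = (\<Sum>i<length xs. (-1) ^ i * a x (xs ! i) * list_pfaffian a (remove_nth i xs))"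
  by pat_completeness auto
termination
  by (relation "Wellfounded.measure (\<lambda>(a, xs). length xs)") auto

declare list_pfaffian.simps(2) [simp del]

lemma list_pfaffian_map: "list_pfaffian a (map g xs) = list_pfaffian (\<lambda>u v. a (g u) (g v)) xs"
proof (induction xs rule: length_induct)
  case (1 xs)
  show ?case
  proof (cases xs)
    case (Cons x ys)
    then show ?thesis using 1
      by (auto intro!: sum.cong simp: list_pfaffian.simps(2) simp flip: map_remove_nth)
  qed simp
qed

text \<open>The same two entries are deleted in either order; the index of the later one drops by
  one if the earlier one goes first, which the case distinctions record.\<close>

lemma remove_nth_remove_nth:
  assumes "i < n" "j < n - 1" "n = length vs"
  shows "remove_nth (if j < i then i - 1 else i) (remove_nth (if j < i then j else Suc j) vs) = remove_nth j (remove_nth i vs)"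
proof (rule nth_equalityI)
  show "length (remove_nth (if j < i then i - 1 else i) (remove_nth (if j < i then j else Suc j) vs)) =
    length (remove_nth j (remove_nth i vs))"
    using assms by auto
  fix k assume "k < length (remove_nth (if j < i then i - 1 else i) (remove_nth (if j < i then j else Suc j) vs))"
  then have "k < n - 2" using assms by (auto split: if_splits)
  then show "remove_nth (if j < i then i - 1 else i) (remove_nth (if j < i then j else Suc j) vs) ! k =
     remove_nth j (remove_nth i vs) ! k"
    using assms by (auto simp: nth_remove_nth)
qed

text \<open>With \<open>x\<close> and \<open>y\<close> in front, expand twice. One term pairs them
  with each other and changes sign by antisymmetry. The others pair them with two entries of
  \<open>vs\<close>; the same pairing arises for the exchanged order with the deletions made in the
  opposite order and with the opposite sign. A longer prefix is expanded along its first entry;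
  deletions may shorten the rest of the prefix, hence the induction on its length.\<close>

lemma list_pfaffian_swap:
  assumes anti: "\<And>u v. a u v = - a v u"
  shows "list_pfaffian a (us @ x # y # vs) = - list_pfaffian a (us @ y # x # vs)"
proof (induction us arbitrary: vs rule: length_induct)
  case (1 us)
  show ?case
  proof (cases us)
    case Nil
    define n where "n = length vs"
    define D where "D x y = (\<Sum>(i,j)\<in>{..<n}\<times>{..<n-1}.
       (-1) ^ Suc (i + j) * a x (vs ! i) * a y (remove_nth i vs ! j) * list_pfaffian a (remove_nth j (remove_nth i vs)))" for x y
    have e: "list_pfaffian a (x # y # vs) = a x y * list_pfaffian a vs + D x y" for x y
    proof -
      have "list_pfaffian a (x # y # vs) = a x y * list_pfaffian a vs + (\<Sum>i<n. (-1) ^ Suc i * a x (vs ! i) * list_pfaffian a (y # remove_nth i vs))"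
        by (simp add: sum.lessThan_Suc_shift n_def list_pfaffian.simps(2)[of a x] del: sum.lessThan_Suc)
      also have "(\<Sum>i<n. (-1) ^ Suc i * a x (vs ! i) * list_pfaffian a (y # remove_nth i vs)) =
         (\<Sum>i<n. \<Sum>j<n-1. (-1) ^ Suc (i + j) * a x (vs ! i) * a y (remove_nth i vs ! j) * list_pfaffian a (remove_nth j (remove_nth i vs)))"
        by (intro sum.cong refl) (simp add: n_def list_pfaffian.simps(2) sum_distrib_left power_add mult_ac)
      also have "\<dots> = D x y"
        unfolding D_def by (simp add: sum.cartesian_product)
      finally show ?thesis .
    qed
    \<comment> \<open>exchanges the order in which two entries of \<open>vs\<close> are removed\<close>
    define \<phi> where "\<phi> = (\<lambda>(i::nat, j::nat). (if j < i then (j, i - 1) else (Suc j, i)))"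
    have "D x y = - D y x"
      unfolding D_def sum_negf [symmetric]
    proof (rule sum.reindex_bij_witness [of _ \<phi> \<phi>])
      fix p assume p: "p \<in> {..<n} \<times> {..<n - 1}"
      obtain i j where ij: "p = (i, j)" "i < n" "j < n - 1" using p by auto
      show "\<phi> (\<phi> p) = p" "\<phi> p \<in> {..<n} \<times> {..<n - 1}" "\<phi> (\<phi> p) = p" "\<phi> p \<in> {..<n} \<times> {..<n - 1}"
        using ij by (auto simp: \<phi>_def)
      define i' j' where "i' = (if j < i then j else Suc j)" and "j' = (if j < i then i - 1 else i)"
      have f: "\<phi> (i, j) = (i', j')" by (auto simp: \<phi>_def i'_def j'_def ij)
      have d: "remove_nth j' (remove_nth i' vs) = remove_nth j (remove_nth i vs)"
        unfolding i'_def j'_def using remove_nth_remove_nth[OF ij(2,3) n_def] .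
      have l: "i' < n" "j' < n - 1" using ij by (auto simp: i'_def j'_def)
      have v: "remove_nth i vs ! j = vs ! i'" "remove_nth i' vs ! j' = vs ! i"
        using ij l by (auto simp: nth_remove_nth n_def i'_def j'_def)
      \<comment> \<open>The sum of the two indices changes by exactly one when the deletions trade
        places.\<close>
      have s: "(-1::real) ^ Suc (i' + j') = - ((-1) ^ Suc (i + j))"
        using ij by (cases i) (auto simp: i'_def j'_def add.commute)
      show "- (case \<phi> p of (i, j) \<Rightarrow> (-1) ^ Suc (i + j) * a y (vs ! i) * a x (remove_nth i vs ! j) * list_pfaffian a (remove_nth j (remove_nth i vs))) =
        (case p of (i, j) \<Rightarrow> (-1) ^ Suc (i + j) * a x (vs ! i) * a y (remove_nth i vs ! j) * list_pfaffian a (remove_nth j (remove_nth i vs)))"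
        unfolding ij(1) f prod.case d v s by (simp add: mult_ac)
    qed
    then show ?thesis using Nil anti[of x y] by (simp add: e)
  next
    case (Cons u us')
    define m where "m = length us'"
    have IH: "list_pfaffian a (ws @ x # y # zs) = - list_pfaffian a (ws @ y # x # zs)" if "length ws \<le> m" for ws zs
      using 1 that Cons by (auto simp: m_def)
    define L where "L = us' @ x # y # vs"
    define L' where "L' = us' @ y # x # vs"
    \<comment> \<open>\<open>\<tau>\<close> sends the position of an entry in \<open>L\<close> to
      its position in \<open>L'\<close>. Deleting \<open>x\<close> or \<open>y\<close> leaves equal
      lists, and the sign comes from the neighbouring positions; for all other entries it comes from
      the induction hypothesis.\<close>
    define \<tau> where "\<tau> i = (if i = m then Suc m else if i = Suc m then m else i)" for i
    have T: "(-1) ^ i * a u (L ! i) * list_pfaffian a (remove_nth i L) = - ((-1) ^ \<tau> i * a u (L' ! \<tau> i) * list_pfaffian a (remove_nth (\<tau> i) L'))"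
      if i: "i < length L" for i
    proof -
      consider "i < m" | "i = m" | "i = Suc m" | k where "i = m + Suc (Suc k)"
        by (metis add_Suc_right less_imp_Suc_add linorder_neqE_nat not_less_eq not_less_iff_gr_or_eq)
      then show ?thesis
      proof cases
        case 1
        with IH[of "remove_nth i us'" vs] show ?thesis
          by (simp add: \<tau>_def L_def L'_def m_def nth_append remove_nth_append_left)
      next
        case 2
        then show ?thesis
          using remove_nth_append_right[of us' 0] remove_nth_append_right[of us' 1]
          by (simp add: \<tau>_def L_def L'_def m_def nth_append )
      next
        case 3
        then show ?thesis
          using remove_nth_append_right[of us' 0] remove_nth_append_right[of us' 1]
          by (simp add: \<tau>_def L_def L'_def m_def nth_append )
      next
        case 4
        then show ?thesis
          using IH[of us' "remove_nth k vs"]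
           remove_nth_append_right[of us' "Suc (Suc k)"]
          by (simp add: \<tau>_def L_def L'_def m_def nth_append )
      qed
    qed
    have "list_pfaffian a (us @ x # y # vs) = (\<Sum>i<length L. (-1) ^ i * a u (L ! i) * list_pfaffian a (remove_nth i L))"
      by (simp add: Cons L_def list_pfaffian.simps(2))
    also have "\<dots> = (\<Sum>i<length L. - ((-1) ^ \<tau> i * a u (L' ! \<tau> i) * list_pfaffian a (remove_nth (\<tau> i) L')))"
      by (intro sum.cong) (auto simp: T)
    also have "\<dots> = (\<Sum>i<length L'. - ((-1) ^ i * a u (L' ! i) * list_pfaffian a (remove_nth i L')))"
      by (rule sum.reindex_bij_witness[of _ \<tau> \<tau>]) (auto simp: \<tau>_def L_def L'_def m_def)
    also have "\<dots> = - list_pfaffian a (us @ y # x # vs)"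
      by (simp add: Cons L'_def list_pfaffian.simps(2) sum_negf)
    finally show ?thesis .
  qed
qed


lemma list_pfaffian_move:
  assumes anti: "\<And>u v. a u v = - a v u"
  shows "list_pfaffian a (us @ x # vs @ ws) = (-1) ^ length vs * list_pfaffian a (us @ vs @ x # ws)"
proof (induction vs arbitrary: us)
  case (Cons v vs)
  have "list_pfaffian a (us @ x # (v # vs) @ ws) = - list_pfaffian a ((us @ [v]) @ x # vs @ ws)"
    using list_pfaffian_swap[of a us x v "vs @ ws", OF anti] by simp
  with Cons[of "us @ [v]"] show ?case by simp
qed simp

text \<open>Both sides carry their left entry across \<open>vs\<close> at the same cost
  \<open>(-1) ^ length vs\<close>; one adjacent exchange then relates the results.\<close>

lemma list_pfaffian_transpose:
  assumes anti: "\<And>u v. a u v = - a v u"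
  shows "list_pfaffian a (us @ x # vs @ y # ws) = - list_pfaffian a (us @ y # vs @ x # ws)"
proof -
  have "list_pfaffian a (us @ x # vs @ y # ws) = (-1) ^ length vs * list_pfaffian a (us @ vs @ x # y # ws)"
    by (rule list_pfaffian_move[OF anti])
  moreover have "list_pfaffian a (us @ vs @ x # y # ws) = - list_pfaffian a (us @ vs @ y # x # ws)"
    using list_pfaffian_swap[of a "us @ vs" x y ws, OF anti] by simp
  moreover have "list_pfaffian a (us @ y # vs @ x # ws) = (-1) ^ length vs * list_pfaffian a (us @ vs @ y # x # ws)"
    by (rule list_pfaffian_move[OF anti])
  ultimately show ?thesis by (simp only: mult_minus_right)
qed

lemma list_pfaffian_repeat:
  assumes anti: "\<And>u v. a u v = - a v u"
  shows "list_pfaffian a (us @ x # vs @ x # ws) = 0"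
  using list_pfaffian_transpose[of a us x vs x ws, OF anti] by linarith

lemma sum_alternating_odd: "odd n \<Longrightarrow> (\<Sum>i<n. (-1) ^ i) = (1::real)"
proof -
  have "(\<Sum>i<n. (-1) ^ i) = (if odd n then 1 else 0 :: real)" by (induction n) auto
  then show "odd n \<Longrightarrow> ?thesis" by simp
qed

lemma set_remove_nth_subset: "set (remove_nth i xs) \<subseteq> set xs"
  by (auto simp: remove_nth_def dest: in_set_takeD in_set_dropD)

lemma sorted_wrt_remove_nth: "sorted_wrt P xs \<Longrightarrow> sorted_wrt P (remove_nth i xs)"
proof (induction xs arbitrary: i)
  case (Cons x xs)
  then show ?case using set_remove_nth_subset[of _ xs] by (cases i) auto
qed (simp add: remove_nth_def)

text \<open>Every minor is 1 by induction, so the first-row expansion is 1 - 1 + ... + 1 with an odd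
  number of terms.\<close>

lemma list_pfaffian_ones:
  assumes "sorted_wrt (\<lambda>u v. a u v = 1) xs" "even (length xs)"
  shows "list_pfaffian a xs = 1"
  using assms
proof (induction "length xs" arbitrary: xs rule: less_induct)
  case less
  show ?case
  proof (cases xs)
    case (Cons x ys)
    have "(-1) ^ i * a x (ys ! i) * list_pfaffian a (remove_nth i ys) = (-1) ^ i" if i: "i < length ys" for i
    proof -
      have "list_pfaffian a (remove_nth i ys) = 1"
      proof (rule less.hyps)
        show "length (remove_nth i ys) < length xs" "even (length (remove_nth i ys))"
          using less.prems(2) i by (simp_all add: Cons)
        show "sorted_wrt (\<lambda>u v. a u v = 1) (remove_nth i ys)"
          using less.prems(1) by (simp add: Cons sorted_wrt_remove_nth)
      qed
      then show ?thesis using less.prems(1) i by (simp add: Cons)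
    qed
    then have "list_pfaffian a xs = (\<Sum>i<length ys. (-1) ^ i)"
      unfolding Cons list_pfaffian.simps(2) by (intro sum.cong) auto
    then show ?thesis using less.prems(2) by (simp add: Cons sum_alternating_odd)
  qed simp
qed


section \<open>The sign of an alcove\<close>

text \<open>Off the integers this is \<open>2\<lfloor>x\<rfloor> + 1\<close>; the symmetric form is odd at the integers as well.\<close>

definition floor_ceil :: "real \<Rightarrow> real" where
  "floor_ceil x = of_int \<lfloor>x\<rfloor> + of_int \<lceil>x\<rceil>"

lemma floor_ceil_minus: "floor_ceil (- x) = - floor_ceil x"
  by (simp add: floor_ceil_def ceiling_def)

lemma floor_ceil_add_int: "floor_ceil (x + of_int n) = floor_ceil x + 2 * of_int n"
  by (simp add: floor_ceil_def)

lemma floor_ceil_unit: "0 < x \<Longrightarrow> x < 1 \<Longrightarrow> floor_ceil x = 1"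
  using floor_eq_iff[of x 0] ceiling_eq_iff[of x 1] by (simp add: floor_ceil_def)

text \<open>\<open>None\<close> is the index of the border.\<close>

fun bordered :: "real option \<Rightarrow> real option \<Rightarrow> real" where
  "bordered None None = 0"
| "bordered None (Some v) = 1"
| "bordered (Some u) None = -1"
| "bordered (Some u) (Some v) = floor_ceil (u - v)"

lemma bordered_anti: "bordered u v = - bordered v u"
proof (cases u; cases v)
  fix x y assume "u = Some x" "v = Some y"
  then show ?thesis using floor_ceil_minus[of "y - x"] by simp
qed auto

lemma bordered_add_int: "bordered (Some (u + of_int n)) r = bordered (Some u) r + 2 * of_int n * bordered None r"
  using floor_ceil_add_int[of "u - _" n] by (cases r) (auto simp: algebra_simps)

text \<open>The Pfaffian is linear in the row of its first entry. Once the shifted entry has been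
  moved there, the added multiple of the border row belongs to a list containing \<open>None\<close>
  twice, and such a Pfaffian vanishes.\<close>

lemma list_pfaffian_bordered_add_int:
  "list_pfaffian bordered (None # us @ Some (u + of_int n) # vs) = list_pfaffian bordered (None # us @ Some u # vs)"
proof -
  have m: "list_pfaffian bordered (None # us @ w # vs) = (-1) ^ Suc (length us) * list_pfaffian bordered (w # None # us @ vs)" for w
    using list_pfaffian_move[of bordered "[]" w "None # us" vs, OF bordered_anti] by simp
  have "list_pfaffian bordered (Some (u + of_int n) # r) = list_pfaffian bordered (Some u # r) + 2 * of_int n * list_pfaffian bordered (None # r)" for r
    by (simp add: list_pfaffian.simps(2) bordered_add_int sum.distrib sum_distrib_left algebra_simps)
  moreover have "list_pfaffian bordered (None # None # us @ vs) = 0"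
    using list_pfaffian_repeat[of bordered "[]" None "[]" "us @ vs", OF bordered_anti] by simp
  ultimately show ?thesis unfolding m by simp
qed

text \<open>The argument is a plain function, so that permuting coordinates is composition.\<close>

definition alcove_sign :: "('k::{finite,linorder} \<Rightarrow> real) \<Rightarrow> real" where
  "alcove_sign y = list_pfaffian bordered (None # map (\<lambda>i. Some (y i)) (sorted_list_of_set UNIV))"

lemma alcove_sign_upd_add_int: "alcove_sign (y(l := y l + of_int n)) = alcove_sign y"
proof -
  obtain us vs where L: "sorted_list_of_set (UNIV :: 'a set) = us @ l # vs"
    by (metis UNIV_I finite set_sorted_list_of_set split_list)
  then have "l \<notin> set us" "l \<notin> set vs"
    using distinct_sorted_list_of_set[of "UNIV :: 'a set"] by auto
  then have m: "map (\<lambda>i. Some (if i = l then y l + of_int n else y i)) zs = map (\<lambda>i. Some (y i)) zs"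
    if "zs = us \<or> zs = vs" for zs
    using that by auto
  show ?thesis
    using list_pfaffian_bordered_add_int[of "map (\<lambda>i. Some (y i)) us" "y l" n]
    by (simp add: alcove_sign_def L m)
qed

text \<open>Coordinates are shifted one at a time; the intermediate translations need not have sum
  zero, so the invariance is obtained under all of Z^k.\<close>

lemma alcove_sign_add_int:
  fixes d :: "'k::{finite,linorder} \<Rightarrow> int"
  shows "alcove_sign (\<lambda>i. y i + of_int (d i)) = alcove_sign y"
proof -
  have "alcove_sign (\<lambda>i. if i \<in> S then y i + of_int (d i) else y i) = alcove_sign y" if "finite S" for S
    using that
  proof induction
    case (insert l S)
    have "(\<lambda>i. if i \<in> insert l S then y i + of_int (d i) else y i) =
      (\<lambda>i. if i \<in> S then y i + of_int (d i) else y i)(l := (if l \<in> S then y l + of_int (d l) else y l) + of_int (d l))"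
      using insert by auto
    then show ?case using insert alcove_sign_upd_add_int[of "\<lambda>i. if i \<in> S then y i + of_int (d i) else y i" l "d l"]
      by simp
  qed simp
  from this[of UNIV] show ?thesis by simp
qed

lemma alcove_sign_transpose:
  assumes "i \<noteq> j"
  shows "alcove_sign (y \<circ> Transposition.transpose i j) = - alcove_sign y"
proof -
  \<comment> \<open>The case in which \<open>i\<close> precedes \<open>j\<close> in the enumeration;
    the other one follows because a transposition is symmetric in its two indices.\<close>
  have *: "alcove_sign (y \<circ> Transposition.transpose i j) = - alcove_sign y"
    if L: "sorted_list_of_set (UNIV :: 'a set) = us @ i # vs @ j # ws" for us vs ws i j
  proof -
    have t: "Transposition.transpose i j l = l" if "l \<in> set us \<union> set vs \<union> set ws" for l
      using distinct_sorted_list_of_set[of "UNIV :: 'a set"] that unfolding L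
      by (auto simp: Transposition.transpose_def)
    have m: "map (\<lambda>l. Some (y (Transposition.transpose i j l))) zs = map (\<lambda>l. Some (y l)) zs"
      if "zs = us \<or> zs = vs \<or> zs = ws" for zs
      using that by (auto simp: t)
    show ?thesis
      using list_pfaffian_transpose[of bordered "None # map (\<lambda>i. Some (y i)) us" "Some (y j)" "map (\<lambda>i. Some (y i)) vs" "Some (y i)" "map (\<lambda>i. Some (y i)) ws", OF bordered_anti]
      by (simp add: alcove_sign_def L m)
  qed
  obtain us vs where L: "sorted_list_of_set (UNIV :: 'a set) = us @ i # vs"
    by (metis UNIV_I finite set_sorted_list_of_set split_list)
  have "j \<in> set us \<or> j \<in> set vs"
    using assms set_sorted_list_of_set[of "UNIV :: 'a set"] unfolding L by auto
  then show ?thesis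
  proof
    assume "j \<in> set us"
    then obtain p q where "us = p @ j # q" by (metis split_list)
    then show ?thesis using *[of p j q i vs] L by (simp add: transpose_commute)
  next
    assume "j \<in> set vs"
    then obtain p q where "vs = p @ j # q" by (metis split_list)
    then show ?thesis using *[of us i p j q] L by simp
  qed
qed

lemma alcove_sign_permute:
  fixes y :: "'k::{finite,linorder} \<Rightarrow> real"
  assumes "p permutes UNIV"
  shows "alcove_sign (y \<circ> p) = of_int (sign p) * alcove_sign y"
  using finite assms
proof (induction p arbitrary: rule: permutes_rev_induct)
  case (swap a b p)
  have "sign (p \<circ> Transposition.transpose a b) = - sign p"
    using swap by (subst sign_compose) (auto simp: sign_swap_id permutation_swap_id intro: permutes_imp_permutation)
  then show ?case
    using swap.IH alcove_sign_transpose[OF swap.hyps(3), of "y \<circ> p"] by (simp only: comp_assoc)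
qed (simp add: sign_id)

lemma alcove_coordinates_close:
  fixes y :: "real ^ 'k::{finite,linorder}"
  assumes y: "y \<in> alcove"
  shows "\<bar>y $ i - y $ j\<bar> < 1"
proof -
  have "y $ b \<le> y $ a" if "a \<le> b" for a b
    using y that by (cases "a = b") (auto simp: alcove_def intro: less_imp_le)
  then have "y $ l \<le> y $ Min UNIV" "y $ Max UNIV \<le> y $ l" for l by simp_all
  from this[of i] this[of j] show ?thesis using y unfolding alcove_def mem_Collect_eq abs_less_iff by linarith
qed

lemma alcove_sign_alcove:
  fixes y :: "real ^ 'k::{finite,linorder}"
  assumes y: "y \<in> alcove" and "odd CARD('k)"
  shows "alcove_sign (($) y) = 1"
  unfolding alcove_sign_def
proof (rule list_pfaffian_ones)
  have "floor_ceil (y $ i - y $ j) = 1" if "i < j" for i j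
  proof (rule floor_ceil_unit)
    show "0 < y $ i - y $ j" using y that by (auto simp: alcove_def)
    show "y $ i - y $ j < 1" using alcove_coordinates_close[OF y, of i j] by simp
  qed
  then show "sorted_wrt (\<lambda>u v. bordered u v = 1) (None # map (\<lambda>i. Some (y $ i)) (sorted_list_of_set UNIV))"
    using strict_sorted_list_of_set[of "UNIV :: 'k set"]
    by (auto simp: sorted_wrt_map intro: sorted_wrt_mono_rel[of _ "(<)"])
qed (use assms in simp)

section \<open>Expansion of the Pfaffian over pair partitions\<close>

lemma pair_partitionsD:
  assumes "\<pi> \<in> pair_partitions I"
  shows "\<Union>\<pi> = I" "B \<in> \<pi> \<Longrightarrow> card B = 2" "B \<in> \<pi> \<Longrightarrow> B \<subseteq> I" "disjoint \<pi>"
  using assms by (auto simp: pair_partitions_def partition_on_def)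

lemma finite_pair_partitions: "finite I \<Longrightarrow> finite (pair_partitions I)"
  by (rule finite_subset[of _ "Pow (Pow I)"]) (auto dest: pair_partitionsD(3))

lemma finite_pair_partition:
  assumes "\<pi> \<in> pair_partitions I" "finite I"
  shows "finite \<pi>"
  using assms pair_partitionsD(1) finite_UnionD by blast

lemma card_2_MinMax:
  fixes B :: "'a::linorder set"
  assumes "card B = 2"
  shows "B = {Min B, Max B}" "Min B < Max B"
proof -
  obtain a b where ab: "a < b" "B = {a, b}"
    using assms by (metis card_2_iff insert_commute linorder_neqE)
  then show "B = {Min B, Max B}" "Min B < Max B" by auto
qed

lemma pair_partitions_empty: "pair_partitions {} = {{}}"
  by (auto simp: pair_partitions_def partition_on_def)

text \<open>A pair partition amounts to the partner \<open>j\<close> of \<open>m\<close> together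
  with a pair partition of the rest; this turns the sum over partitions into a first-row
  expansion.\<close>

lemma bij_betw_pair_partitions:
  fixes I :: "'a set"
  assumes m: "m \<in> I"
  shows "bij_betw (\<lambda>(j, \<pi>). insert {m, j} \<pi>) (SIGMA j:I - {m}. pair_partitions (I - {m, j})) (pair_partitions I)"
proof (rule bij_betw_imageI)
  show "inj_on (\<lambda>(j, \<pi>). insert {m, j} \<pi>) (SIGMA j:I - {m}. pair_partitions (I - {m, j}))"
  proof (rule inj_onI, unfold split_paired_all mem_Sigma_iff split, elim conjE)
    fix j \<pi> j' \<pi>'
    assume j: "j \<in> I - {m}" "j' \<in> I - {m}"
      and p: "\<pi> \<in> pair_partitions (I - {m, j})" "\<pi>' \<in> pair_partitions (I - {m, j'})"
      and e: "insert {m, j} \<pi> = insert {m, j'} \<pi>'"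
    \<comment> \<open>No old block contains \<open>m\<close>, so the new block can be recovered from
      the enlarged partition.\<close>
    have n: "{m, x} \<notin> \<pi>" "{m, x} \<notin> \<pi>'" for x
      using pair_partitionsD(1)[OF p(1)] pair_partitionsD(1)[OF p(2)] by auto
    then have "{m, j} = {m, j'}" using e by (metis insertE insertI1)
    then have "j = j'" using j by (auto simp: doubleton_eq_iff)
    then show "(j, \<pi>) = (j', \<pi>')" using e n by (metis insert_ident)
  qed
  show "(\<lambda>(j, \<pi>). insert {m, j} \<pi>) ` (SIGMA j:I - {m}. pair_partitions (I - {m, j})) = pair_partitions I"
  proof (intro equalityI subsetI)
    fix \<rho> assume "\<rho> \<in> (\<lambda>(j, \<pi>). insert {m, j} \<pi>) ` (SIGMA j:I - {m}. pair_partitions (I - {m, j}))"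
    then obtain j \<pi> where j: "j \<in> I" "j \<noteq> m" and p: "\<pi> \<in> pair_partitions (I - {m, j})" and r: "\<rho> = insert {m, j} \<pi>"
      by auto
    have "C \<inter> {m, j} = {}" if "C \<in> \<pi>" for C
      using pair_partitionsD(3)[OF p that] by auto
    then have "disjoint \<rho>"
      unfolding r using pair_partitionsD(4)[OF p] by (auto simp: disjoint_def)
    then show "\<rho> \<in> pair_partitions I"
      using pair_partitionsD(1,2)[OF p] p j m unfolding r
      by (auto simp: pair_partitions_def partition_on_def)
  next
    fix \<rho> assume r: "\<rho> \<in> pair_partitions I"
    obtain B where B: "B \<in> \<rho>" "m \<in> B" using pair_partitionsD(1)[OF r] m by auto
    obtain j where j: "B = {m, j}" "j \<noteq> m"
      using pair_partitionsD(2)[OF r B(1)] B(2) by (metis card_2_iff insertE insert_commute singletonD)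
    have d: "C \<inter> B = {}" if "C \<in> \<rho>" "C \<noteq> B" for C
      using pair_partitionsD(4)[OF r] B that by (auto simp: disjoint_def)
    have "\<Union>(\<rho> - {B}) = \<Union>\<rho> - B"
    proof (intro equalityI subsetI)
      show "x \<in> \<Union>\<rho> - B" if "x \<in> \<Union>(\<rho> - {B})" for x using that d by blast
    qed auto
    then have "\<Union>(\<rho> - {B}) = I - {m, j}"
      using pair_partitionsD(1)[OF r] j(1) by simp
    then have "\<rho> - {B} \<in> pair_partitions (I - {m, j})"
      using r by (auto simp: pair_partitions_def partition_on_def disjoint_def)
    moreover have "j \<in> I" using pair_partitionsD(3)[OF r B(1)] j by auto
    moreover have "\<rho> = insert {m, j} (\<rho> - {B})" using B j by auto
    ultimately show "\<rho> \<in> (\<lambda>(j, \<pi>). insert {m, j} \<pi>) ` (SIGMA j:I - {m}. pair_partitions (I - {m, j}))"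
      using j(2) by (intro image_eqI[of _ _ "(j, \<rho> - {B})"]) auto
  qed
qed

text \<open>Since \<open>m\<close> lies below all of \<open>I\<close>, the block
  \<open>{m, j}\<close> can only be the left member of a crossing, and it crosses exactly the blocks
  with one end on each side of \<open>j\<close>.\<close>

lemma crossings_insert:
  fixes I :: "'a::linorder set"
  assumes p: "\<pi> \<in> pair_partitions I" and I: "finite I" and m: "\<And>x. x \<in> I \<Longrightarrow> m < x" and j: "m < j"
  shows "crossings (insert {m, j} \<pi>) = crossings \<pi> + card {B \<in> \<pi>. Min B < j \<and> j < Max B}"
proof -
  let ?old = "{(B, B'). B \<in> \<pi> \<and> B' \<in> \<pi> \<and> Min B < Min B' \<and> Min B' < Max B \<and> Max B < Max B'}"
  let ?new = "{B \<in> \<pi>. Min B < j \<and> j < Max B}"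
  have fin: "finite \<pi>" using finite_pair_partition[OF p I] .
  have B: "Min B \<in> I" if "B \<in> \<pi>" for B
    using card_2_MinMax(1)[OF pair_partitionsD(2)[OF p that]] pair_partitionsD(3)[OF p that] by blast
  have mj: "Min {m, j} = m" "Max {m, j} = j" using j by auto
  have mB: "m < Min B" "\<not> Min B < m" if "B \<in> \<pi>" for B
    using m[OF B[OF that]] by auto
  have "{m, j} \<notin> \<pi>" using mB(1)[of "{m, j}"] mj by auto
  then have "{(B, B'). B \<in> insert {m, j} \<pi> \<and> B' \<in> insert {m, j} \<pi> \<and>
     Min B < Min B' \<and> Min B' < Max B \<and> Max B < Max B'} = ?old \<union> Pair {m, j} ` ?new"
    using mB mj j by (auto simp del: Min_insert Max_insert)
  moreover have "finite ?old" by (rule finite_subset[of _ "\<pi> \<times> \<pi>"]) (use fin in auto)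
  moreover have "?old \<inter> Pair {m, j} ` ?new = {}" using \<open>{m, j} \<notin> \<pi>\<close> by auto
  ultimately show ?thesis
    unfolding crossings_def using fin by (simp add: card_Un_disjoint card_image inj_on_def)
qed

text \<open>Count the elements below \<open>j\<close> block by block: a block contributes 0, 1 or 2
  of them, and an odd number exactly when it straddles \<open>j\<close>.\<close>

lemma parity_straddling:
  fixes I :: "'a::linorder set"
  assumes p: "\<pi> \<in> pair_partitions I" and I: "finite I" and j: "j \<notin> I"
  shows "(-1) ^ card {B \<in> \<pi>. Min B < j \<and> j < Max B} = ((-1) ^ card {x \<in> I. x < j} :: real)"
proof -
  have fin: "finite \<pi>" using finite_pair_partition[OF p I] .
  have "{x \<in> I. x < j} = (\<Union>B\<in>\<pi>. {x \<in> B. x < j})"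
    using pair_partitionsD(1)[OF p] by auto
  moreover have "finite B" if "B \<in> \<pi>" for B
    using pair_partitionsD(3)[OF p that] I finite_subset by auto
  ultimately have "card {x \<in> I. x < j} = (\<Sum>B\<in>\<pi>. card {x \<in> B. x < j})"
    using fin pair_partitionsD(4)[OF p] by (simp, subst card_UN_disjoint) (auto simp: disjoint_def)
  then have "((-1) ^ card {x \<in> I. x < j} :: real) = (\<Prod>B\<in>\<pi>. (-1) ^ card {x \<in> B. x < j})"
    by (simp add: power_sum)
  also have "\<dots> = (\<Prod>B\<in>\<pi>. if Min B < j \<and> j < Max B then -1 else 1)"
  proof (rule prod.cong)
    fix B assume B: "B \<in> \<pi>"
    obtain a b where ab: "B = {a, b}" "a < b" "Min B = a" "Max B = b"
      using card_2_MinMax[OF pair_partitionsD(2)[OF p B]] by blast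
    have "j \<noteq> a" "j \<noteq> b" using pair_partitionsD(3)[OF p B] j ab(1) by auto
    then consider "b < j" | "a < j" "j < b" | "j < a" by (meson neq_iff)
    then show "(-1) ^ card {x \<in> B. x < j} = (if Min B < j \<and> j < Max B then -1 else 1 :: real)"
    proof cases
      case 1
      then have e: "{x \<in> B. x < j} = {a, b}" using ab(1,2) by auto
      have "card {x \<in> B. x < j} = 2" using arg_cong[OF e, of card] ab(2) by simp
      moreover have "\<not> j < b" using 1 by simp
      ultimately show ?thesis by (simp add: ab(3,4))
    next
      case 2
      then have e: "{x \<in> B. x < j} = {a}" using ab(1) by auto
      have "card {x \<in> B. x < j} = 1" using arg_cong[OF e, of card] ab(2) by simp
      then show ?thesis using 2 by (simp add: ab(3,4))
    next
      case 3
      then have e: "{x \<in> B. x < j} = {}" using ab(1,2) by auto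
      have "card {x \<in> B. x < j} = 0" using arg_cong[OF e, of card] ab(2) by simp
      moreover have "\<not> a < j" using 3 by simp
      ultimately show ?thesis by (simp add: ab(3,4))
    qed
  qed simp
  also have "\<dots> = (-1) ^ card {B \<in> \<pi>. Min B < j \<and> j < Max B}"
    using fin by (simp flip: prod.inter_filter)
  finally show ?thesis by simp
qed

text \<open>The number of blocks crossing \<open>{m, j}\<close> depends on the partition, but its
  parity is fixed by the position of \<open>j\<close>, so the sign can be taken out of the inner
  sum.\<close>

lemma pfaffian_expand:
  fixes I :: "'a::linorder set"
  assumes I: "finite I" "I \<noteq> {}" and m: "m = Min I"
  shows "pfaffian I a = (\<Sum>j\<in>I - {m}. (-1) ^ card {x \<in> I - {m}. x < j} * a m j * pfaffian (I - {m, j}) a)"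
proof -
  have mI: "m \<in> I" using I m by auto
  have less: "m < x" if "x \<in> I - {m}" for x using I m that by (metis DiffD1 DiffD2 Min_le insertI1 le_neq_trans)
  let ?t = "\<lambda>\<pi>. (-1) ^ crossings \<pi> * (\<Prod>B\<in>\<pi>. a (Min B) (Max B))"
  have "pfaffian I a = (\<Sum>(j, \<pi>)\<in>(SIGMA j:I - {m}. pair_partitions (I - {m, j})). ?t (insert {m, j} \<pi>))"
    unfolding pfaffian_def
    using sum.reindex_bij_betw[OF bij_betw_pair_partitions[OF mI], of ?t] by (simp add: case_prod_unfold)
  also have "\<dots> = (\<Sum>j\<in>I - {m}. \<Sum>\<pi>\<in>pair_partitions (I - {m, j}). ?t (insert {m, j} \<pi>))"
    using I by (simp add: sum.Sigma finite_pair_partitions)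
  also have "\<dots> = (\<Sum>j\<in>I - {m}. \<Sum>\<pi>\<in>pair_partitions (I - {m, j}).
      (-1) ^ card {x \<in> I - {m}. x < j} * a m j * ?t \<pi>)"
  proof (intro sum.cong refl)
    fix j \<pi> assume j: "j \<in> I - {m}" and p: "\<pi> \<in> pair_partitions (I - {m, j})"
    have fin: "finite \<pi>" using finite_pair_partition[OF p] I by auto
    have "{m, j} \<notin> \<pi>" using pair_partitionsD(1)[OF p] by auto
    then have 1: "(\<Prod>B\<in>insert {m, j} \<pi>. a (Min B) (Max B)) = a m j * (\<Prod>B\<in>\<pi>. a (Min B) (Max B))"
      using fin less[OF j] by simp
    have 2: "crossings (insert {m, j} \<pi>) = crossings \<pi> + card {B \<in> \<pi>. Min B < j \<and> j < Max B}"
      using crossings_insert[OF p] I less j by auto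
    have 3: "(-1) ^ card {B \<in> \<pi>. Min B < j \<and> j < Max B} = ((-1) ^ card {x \<in> I - {m, j}. x < j} :: real)"
      using parity_straddling[OF p] I by auto
    have "{x \<in> I - {m, j}. x < j} = {x \<in> I - {m}. x < j}" by auto
    then show "?t (insert {m, j} \<pi>) = (-1) ^ card {x \<in> I - {m}. x < j} * a m j * ?t \<pi>"
      using 3 by (simp add: 1 2 power_add)
  qed
  also have "\<dots> = (\<Sum>j\<in>I - {m}. (-1) ^ card {x \<in> I - {m}. x < j} * a m j * pfaffian (I - {m, j}) a)"
    by (simp add: pfaffian_def sum_distrib_left)
  finally show ?thesis .
qed

section \<open>Agreement of the Pfaffian of a set with that of its sorted list\<close>

lemma remove_nth_sorted_list_of_set:
  assumes "finite I" "i < card I"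
  shows "remove_nth i (sorted_list_of_set I) = sorted_list_of_set (I - {sorted_list_of_set I ! i})"
proof (rule strict_sorted_equal)
  let ?xs = "sorted_list_of_set I"
  show "sorted_wrt (<) (remove_nth i ?xs)" by (intro sorted_wrt_remove_nth) simp
  have "?xs = take i ?xs @ ?xs ! i # drop (Suc i) ?xs"
    using assms by (simp add: id_take_nth_drop)
  then have "distinct (take i ?xs @ ?xs ! i # drop (Suc i) ?xs)" "set (take i ?xs @ ?xs ! i # drop (Suc i) ?xs) = I"
    using assms by (metis distinct_sorted_list_of_set, metis set_sorted_list_of_set)
  then show "set (remove_nth i ?xs) = set (sorted_list_of_set (I - {?xs ! i}))"
    using assms by (auto simp: remove_nth_def)
qed simp

lemma card_less_sorted_list_of_set:
  assumes I: "finite I" and i: "i < card I"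
  shows "card {x \<in> I. x < sorted_list_of_set I ! i} = i"
proof -
  let ?xs = "sorted_list_of_set I"
  have s: "sorted_wrt (<) ?xs" by simp
  have *: "?xs ! j < ?xs ! k \<longleftrightarrow> j < k" if "j < card I" "k < card I" for j k
    using that sorted_wrt_nth_less[OF s, of j k] sorted_wrt_nth_less[OF s, of k j]
    by (metis length_sorted_list_of_set linorder_neqE_nat order_less_asym order_less_irrefl)
  have "{x \<in> I. x < ?xs ! i} = (!) ?xs ` {..<i}"
  proof (intro equalityI subsetI)
    fix x assume x: "x \<in> {x \<in> I. x < ?xs ! i}"
    then obtain j where "j < card I" "x = ?xs ! j"
      using I by (metis (no_types, lifting) in_set_conv_nth length_sorted_list_of_set mem_Collect_eq set_sorted_list_of_set)
    then show "x \<in> (!) ?xs ` {..<i}" using x * i by auto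
  next
    fix x assume "x \<in> (!) ?xs ` {..<i}"
    then show "x \<in> {x \<in> I. x < ?xs ! i}"
      using * i I nth_mem[of _ ?xs] by auto
  qed
  moreover have "inj_on ((!) ?xs) {..<i}"
    using i by (auto simp: inj_on_def nth_eq_iff_index_eq)
  ultimately show ?thesis by (simp add: card_image)
qed

lemma bij_betw_sorted_list_of_set:
  "finite I \<Longrightarrow> bij_betw ((!) (sorted_list_of_set I)) {..<card I} I"
  by (rule bij_betw_nth) auto

text \<open>Both sides satisfy the same expansion along the least index; the entry at place
  \<open>i\<close> of the sorted list has exactly \<open>i\<close> smaller elements, so the signs
  match.\<close>

lemma pfaffian_eq_list_pfaffian:
  fixes I :: "'a::linorder set"
  assumes "finite I"
  shows "pfaffian I a = list_pfaffian a (sorted_list_of_set I)"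
  using assms
proof (induction "card I" arbitrary: I rule: less_induct)
  case less
  show ?case
  proof (cases "I = {}")
    case True
    then show ?thesis by (simp add: pfaffian_def pair_partitions_empty crossings_def)
  next
    case False
    define m where "m = Min I"
    define J where "J = I - {m}"
    have J: "finite J" "card J < card I"
      using less.prems False by (auto simp: J_def m_def card_gt_0_iff intro!: card_Diff1_less)
    let ?xs = "sorted_list_of_set J"
    have "pfaffian I a = (\<Sum>j\<in>J. (-1) ^ card {x \<in> J. x < j} * a m j * pfaffian (I - {m, j}) a)"
      using pfaffian_expand[OF less.prems False m_def] by (simp add: J_def)
    also have "\<dots> = (\<Sum>i<card J. (-1) ^ card {x \<in> J. x < ?xs ! i} * a m (?xs ! i) * pfaffian (I - {m, ?xs ! i}) a)"
      by (rule sum.reindex_bij_betw[OF bij_betw_sorted_list_of_set[OF J(1)], symmetric])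
    also have "\<dots> = (\<Sum>i<card J. (-1) ^ i * a m (?xs ! i) * list_pfaffian a (remove_nth i ?xs))"
    proof (intro sum.cong refl)
      fix i assume "i \<in> {..<card J}"
      then have i: "i < card J" by simp
      have e: "I - {m, ?xs ! i} = J - {?xs ! i}" by (auto simp: J_def)
      have "card (J - {?xs ! i}) < card I"
        using J card_Diff1_le[of J "?xs ! i"] by linarith
      then have "pfaffian (I - {m, ?xs ! i}) a = list_pfaffian a (remove_nth i ?xs)"
        unfolding e remove_nth_sorted_list_of_set[OF J(1) i] using less.hyps J by blast
      then show "(-1) ^ card {x \<in> J. x < ?xs ! i} * a m (?xs ! i) * pfaffian (I - {m, ?xs ! i}) a =
        (-1) ^ i * a m (?xs ! i) * list_pfaffian a (remove_nth i ?xs)"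
        by (simp add: card_less_sorted_list_of_set[OF J(1) i])
    qed
    also have "\<dots> = list_pfaffian a (sorted_list_of_set I)"
      using sorted_list_of_set_nonempty[OF less.prems False] by (simp add: list_pfaffian.simps(2) J_def m_def)
    finally show ?thesis .
  qed
qed

lemma alcove_sign_eq_pfaffian:
  fixes y :: "'k::{finite,linorder} \<Rightarrow> real"
  shows "alcove_sign y = (\<Sum>l\<in>UNIV. (-1) ^ (index_pos l + 1) * pfaffian (UNIV - {l}) (\<lambda>i j. floor_ceil (y i - y j)))"
proof -
  let ?L = "sorted_list_of_set (UNIV :: 'k set)"
  have "(\<Sum>l\<in>UNIV. (-1) ^ (index_pos l + 1) * pfaffian (UNIV - {l}) (\<lambda>i j. floor_ceil (y i - y j))) =
    (\<Sum>i<CARD('k). (-1) ^ (index_pos (?L ! i) + 1) * pfaffian (UNIV - {?L ! i}) (\<lambda>i j. floor_ceil (y i - y j)))"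
    by (rule sum.reindex_bij_betw[OF bij_betw_sorted_list_of_set, symmetric]) simp
  also have "\<dots> = (\<Sum>i<CARD('k). (-1) ^ i * list_pfaffian bordered (remove_nth i (map (\<lambda>i. Some (y i)) ?L)))"
  proof (intro sum.cong refl)
    fix i assume "i \<in> {..<CARD('k)}"
    then have i: "i < CARD('k)" by simp
    \<comment> \<open>\<open>index_pos\<close> counts the index itself, so place \<open>i\<close> of
      the list has position \<open>Suc i\<close>, and the exponent in the statement exceeds
      \<open>i\<close> by 2.\<close>
    have "{..?L ! i} = insert (?L ! i) {x \<in> UNIV. x < ?L ! i}" by auto
    then have "index_pos (?L ! i) = Suc i"
      unfolding index_pos_def using card_less_sorted_list_of_set[OF finite i] by simp
    then show "(-1) ^ (index_pos (?L ! i) + 1) * pfaffian (UNIV - {?L ! i}) (\<lambda>i j. floor_ceil (y i - y j)) =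
       (-1) ^ i * list_pfaffian bordered (remove_nth i (map (\<lambda>i. Some (y i)) ?L))"
      by (simp add: pfaffian_eq_list_pfaffian list_pfaffian_map remove_nth_sorted_list_of_set i flip: map_remove_nth)
  qed
  also have "\<dots> = alcove_sign y"
    by (simp add: alcove_sign_def list_pfaffian.simps(2))
  finally show ?thesis by simp
qed

section \<open>The affine Weyl group\<close>

lemma perm_map_nth: "p permutes UNIV \<Longrightarrow> perm_map p y $ j = y $ inv p j"
proof -
  assume p: "p permutes UNIV"
  have "perm_map p y $ j = (\<Sum>i\<in>UNIV. if i = inv p j then y $ i else 0)"
    unfolding perm_map_def sum_component
    by (intro sum.cong) (auto simp: axis_def permutes_inverses[OF p])
  then show ?thesis by simp
qed

lemma affine_weyl_groupE:
  assumes "\<omega> \<in> affine_weyl_group"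
  obtains p d where "p permutes UNIV" "d \<in> zero_sum_lattice" "\<omega> = (\<lambda>y. perm_map p y + d)"
    "\<And>y j. \<omega> y $ j = y $ inv p j + d $ j"
  using assms by (auto simp: affine_weyl_group_def perm_map_nth)

lemma weyl_sign_affine:
  fixes d :: "real ^ 'k::finite"
  assumes p: "p permutes UNIV"
  shows "weyl_sign (\<lambda>y. perm_map p y + d) = of_int (sign p)"
proof -
  have "perm_map p y + d - (perm_map p 0 + d) = perm_map p y" for y
    by (simp add: perm_map_def)
  moreover have "matrix (perm_map p) = (\<chi> i j. (mat 1 :: real ^ 'k ^ 'k) $ i $ p j)"
    using permutes_inv_eq[OF p]
    by (auto simp: matrix_def perm_map_nth[OF p] axis_def mat_def vec_eq_iff)
  ultimately show ?thesis
    using det_permute_columns[OF p, of "mat 1 :: real ^ 'k ^ 'k"] by (simp add: weyl_sign_def)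
qed

lemma alcove_sign_affine_weyl_group:
  fixes y :: "real ^ 'k::{finite,linorder}"
  assumes \<omega>: "\<omega> \<in> affine_weyl_group" and y: "y \<in> alcove" and odd: "odd CARD('k)"
  shows "alcove_sign (($) (\<omega> y)) = weyl_sign \<omega>"
proof -
  obtain p d where p: "p permutes UNIV" and d: "d \<in> zero_sum_lattice"
    and w: "\<omega> = (\<lambda>y. perm_map p y + d)" "\<And>y j. \<omega> y $ j = y $ inv p j + d $ j"
    using affine_weyl_groupE[OF \<omega>] by metis
  \<comment> \<open>The floor merely presents the integral coordinates of \<open>d\<close> as values
    of type \<open>int\<close>.\<close>
  have "($) (\<omega> y) = (\<lambda>i. (($) y \<circ> inv p) i + of_int \<lfloor>d $ i\<rfloor>)"
    using d by (auto simp: w(2) zero_sum_lattice_def)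
  then have "alcove_sign (($) (\<omega> y)) = alcove_sign (($) y \<circ> inv p)"
    by (simp only: alcove_sign_add_int)
  also have "\<dots> = of_int (sign p)"
    using alcove_sign_permute[OF permutes_inv[OF p], of "($) y"] alcove_sign_alcove[OF y odd] p
    by (simp add: sign_inverse permutes_imp_permutation[OF finite])
  finally show ?thesis using weyl_sign_affine[OF p, of d] w(1) by simp
qed

section \<open>Existence and uniqueness of the alcove containing a point off the walls\<close>

lemma strict_mono_permutes_id:
  fixes r :: "'k::{finite,linorder} \<Rightarrow> 'k"
  assumes r: "r permutes UNIV" and mono: "\<And>i j. i < j \<Longrightarrow> r i < r j"
  shows "r = id"
proof
  fix i
  have "x \<in> r ` {..<i}" if "x < r i" for x
  proof -
    obtain k where "x = r k" using permutes_surj[OF r] by (metis surjD)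
    then have "k < i" using mono[of i k] that by (metis less_asym linorder_neqE)
    then show ?thesis using \<open>x = r k\<close> by auto
  qed
  \<comment> \<open>Initial segments are mapped onto initial segments, and in a finite linear order
    their cardinality determines the end point.\<close>
  then have "{..<r i} = r ` {..<i}" using mono by auto
  then have c: "card {..<r i} = card {..<i}"
    using card_image[OF permutes_inj_on[OF r, of "{..<i}"]] by simp
  have "r i < i \<Longrightarrow> {..<r i} \<subset> {..<i}" "i < r i \<Longrightarrow> {..<i} \<subset> {..<r i}" by auto
  then show "r i = id i"
    using c psubset_card_mono[of "{..<i}" "{..<r i}"] psubset_card_mono[of "{..<r i}" "{..<i}"]
    by (metis finite id_apply less_irrefl linorder_neqE)
qed

text \<open>The two translation parts differ by an integral vector \<open>e\<close> with sum zero.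
  Its entries cannot be positive at one index and negative at another, so \<open>e = 0\<close>. What
  remains is a permutation relating two strictly decreasing coordinate vectors, hence the
  identity.\<close>

lemma alcove_disjoint:
  fixes y y' :: "real ^ 'k::{finite,linorder}"
  assumes \<omega>: "\<omega> \<in> affine_weyl_group" "\<omega>' \<in> affine_weyl_group"
    and y: "y \<in> alcove" "y' \<in> alcove" and eq: "\<omega> y = \<omega>' y'"
  shows "\<omega> = \<omega>'"
proof -
  obtain p d where p: "p permutes UNIV" and d: "d \<in> zero_sum_lattice"
    and w: "\<omega> = (\<lambda>y. perm_map p y + d)" "\<And>y j. \<omega> y $ j = y $ inv p j + d $ j"
    using affine_weyl_groupE[OF \<omega>(1)] by metis
  obtain p' d' where p': "p' permutes UNIV" and d': "d' \<in> zero_sum_lattice"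
    and w': "\<omega>' = (\<lambda>y. perm_map p' y + d')" "\<And>y j. \<omega>' y $ j = y $ inv p' j + d' $ j"
    using affine_weyl_groupE[OF \<omega>(2)] by metis
  define e where "e j = d' $ j - d $ j" for j
  have e: "e j = y $ inv p j - y' $ inv p' j" for j
    using eq w(2)[of y j] w'(2)[of y' j] by (simp add: e_def)
  have e_int: "e j \<in> \<int>" for j using d d' by (simp add: e_def zero_sum_lattice_def)
  have e_sum: "(\<Sum>j\<in>UNIV. e j) = 0" using d d' by (simp add: e_def zero_sum_lattice_def sum_subtractf)
  \<comment> \<open>Coordinates of a point of the alcove differ by less than 1, so two entries of
    \<open>e\<close> differ by less than 2.\<close>
  have no: False if "e j \<ge> 1" "e i \<le> -1" for i j
    using that alcove_coordinates_close[OF y(1), of "inv p j" "inv p i"] alcove_coordinates_close[OF y(2), of "inv p' j" "inv p' i"]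
    unfolding e by linarith
  have pos: "e j \<ge> 1" if "e j > 0" for j
    using e_int[of j] that by (auto elim!: Ints_cases)
  have neg: "e j \<le> -1" if "e j < 0" for j
    using e_int[of j] that by (auto elim!: Ints_cases)
  have e0: "e j = 0" for j
  proof (cases "\<forall>i. e i \<le> 0")
    case True
    then show ?thesis using e_sum sum_nonneg_eq_0_iff[of UNIV "\<lambda>i. - e i"] by (simp add: sum_negf)
  next
    case False
    then have "\<forall>i. e i \<ge> 0" using no pos neg by (meson not_le)
    then show ?thesis using e_sum sum_nonneg_eq_0_iff[of UNIV e] by simp
  qed
  define r where "r = inv p \<circ> p'"
  have r: "r permutes UNIV" unfolding r_def by (rule permutes_compose[OF p' permutes_inv[OF p]])
  have "y $ r i = y' $ i" for i
    using e[of "p' i"] e0[of "p' i"] permutes_inverses(2)[OF p'] by (simp add: r_def)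
  then have "r i < r j" if "i < j" for i j
    using that y unfolding alcove_def by (metis (mono_tags, lifting) less_asym less_irrefl linorder_neqE mem_Collect_eq)
  then have "r = id" using strict_mono_permutes_id[OF r] by blast
  then have "p \<circ> r = p" by simp
  then have "p' = p" unfolding r_def using permutes_inv_o(1)[OF p] by (simp add: o_assoc)
  moreover have "d = d'" using e0 by (simp add: e_def vec_eq_iff)
  ultimately show ?thesis using w(1) w'(1) by simp
qed

text \<open>\<open>r\<close> ranks the coordinates from the largest down, \<open>q\<close> turns the
  rank into an index, and the inverse of \<open>q\<close> lists the coordinates in decreasing
  order.\<close>

lemma sorting_permutation:
  fixes x :: "'k::{finite,linorder} \<Rightarrow> real"
  assumes inj: "inj x"
  obtains p where "p permutes UNIV" "\<And>i j. i < j \<Longrightarrow> x (p j) < x (p i)"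
proof -
  define r where "r i = card {j. x i < x j}" for i
  have r_less: "r i < r j" if "x j < x i" for i j
    unfolding r_def using that by (intro psubset_card_mono) auto
  have r_lt: "r i < CARD('k)" for i
    unfolding r_def by (rule psubset_card_mono) auto
  define q where "q i = sorted_list_of_set (UNIV :: 'k set) ! r i" for i
  have q_less: "q i < q j" if "x j < x i" for i j
    unfolding q_def using r_less[OF that] r_lt[of j]
    by (intro sorted_wrt_nth_less[of "(<)"]) auto
  have "inj q"
  proof (rule injI)
    fix i j assume "q i = q j"
    then have "x i = x j" using q_less[of i j] q_less[of j i] by (metis less_irrefl linorder_neqE)
    then show "i = j" using inj by (simp add: inj_eq)
  qed
  then have q: "q permutes UNIV"
    by (intro bij_imp_permutes bijI finite_UNIV_inj_surj) auto
  show ?thesis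
  proof (rule that[OF permutes_inv[OF q]])
    fix i j :: 'k assume ij: "i < j"
    have "\<not> x (inv q i) < x (inv q j)"
      using q_less[of "inv q i" "inv q j"] ij by (auto simp: permutes_inverses[OF q])
    moreover have "x (inv q i) \<noteq> x (inv q j)"
      using ij inj by (simp add: inj_eq permutes_inv_eq[OF q] permutes_inverses[OF q])
    ultimately show "x (inv q j) < x (inv q i)" by simp
  qed
qed

text \<open>Lowering the largest coordinate or raising the smallest one by \<open>1\<close> keeps all differences below \<open>1\<close>
  and changes the sum of the translation by \<open>1\<close>, so every value of the sum is attained.\<close>

lemma unit_spread_translate:
  fixes y :: "'k::finite \<Rightarrow> real" and n :: int
  assumes y: "\<And>i j. i \<noteq> j \<Longrightarrow> y i - y j \<notin> \<int>"
  shows "\<exists>d :: 'k \<Rightarrow> int. (\<Sum>i\<in>UNIV. d i) = n \<and> (\<forall>i j. \<bar>(y i - d i) - (y j - d j)\<bar> < 1)"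
proof (induction n rule: int_induct[where k = "\<Sum>i\<in>UNIV. \<lfloor>y i\<rfloor>"])
  \<comment> \<open>Start from the integer parts: the remainders all lie in [0, 1).\<close>
  case base
  have "\<bar>(y i - \<lfloor>y i\<rfloor>) - (y j - \<lfloor>y j\<rfloor>)\<bar> < 1" for i j by linarith
  then show ?case by (intro exI[of _ "\<lambda>i. \<lfloor>y i\<rfloor>"]) simp
next
  case (step1 n)
  then obtain d where d: "(\<Sum>i\<in>UNIV. d i) = n" "\<And>i j. \<bar>(y i - real_of_int (d i)) - (y j - d j)\<bar> < 1"
    by blast
  \<comment> \<open>Rules out ties: an entry equal to the largest one would be at distance exactly 1
    from it after the lowering.\<close>
  have ne: "y i - d i \<noteq> y j - d j" if "i \<noteq> j" for i j
  proof
    assume "y i - d i = y j - d j"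
    then have "y i - y j = of_int (d i - d j)" by simp
    then show False using y[OF that] by (metis Ints_of_int)
  qed
  obtain m where m: "\<And>i. y i - d i \<le> y m - d m"
    using Max_in[of "range (\<lambda>i. y i - d i)"] Max_ge[of "range (\<lambda>i. y i - d i)"] by fastforce
  have "\<bar>(y i - real_of_int ((d(m := d m + 1)) i)) - (y j - (d(m := d m + 1)) j)\<bar> < 1" for i j
    using d(2)[of i j] m[of i] m[of j] ne[of i m] ne[of j m] by auto
  then show ?case using d(1)
    by (intro exI[of _ "d(m := d m + 1)"]) (auto simp: fun_upd_def sum.If_cases sum.remove[of UNIV m d] Compl_eq_Diff_UNIV Collect_neg_eq)
next
  case (step2 n)
  then obtain d where d: "(\<Sum>i\<in>UNIV. d i) = n" "\<And>i j. \<bar>(y i - real_of_int (d i)) - (y j - d j)\<bar> < 1"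
    by blast
  have ne: "y i - d i \<noteq> y j - d j" if "i \<noteq> j" for i j
  proof
    assume "y i - d i = y j - d j"
    then have "y i - y j = of_int (d i - d j)" by simp
    then show False using y[OF that] by (metis Ints_of_int)
  qed
  obtain m where m: "\<And>i. y m - d m \<le> y i - d i"
    using Min_in[of "range (\<lambda>i. y i - d i)"] Min_le[of "range (\<lambda>i. y i - d i)"] by fastforce
  have "\<bar>(y i - real_of_int ((d(m := d m - 1)) i)) - (y j - (d(m := d m - 1)) j)\<bar> < 1" for i j
    using d(2)[of i j] m[of i] m[of j] ne[of i m] ne[of j m] by auto
  then show ?case using d(1)
    by (intro exI[of _ "d(m := d m - 1)"]) (auto simp: fun_upd_def sum.If_cases sum.remove[of UNIV m d] Compl_eq_Diff_UNIV Collect_neg_eq)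
qed

text \<open>An integral translation with sum zero brings all coordinates within distance 1 of each
  other; sorting them then yields a point of the alcove. The hypothesis keeps the translated
  coordinates distinct.\<close>

lemma alcove_cover:
  fixes y :: "real ^ 'k::{finite,linorder}"
  assumes y: "\<And>i j. i \<noteq> j \<Longrightarrow> y $ i - y $ j \<notin> \<int>"
  shows "\<exists>\<omega>\<in>affine_weyl_group. y \<in> \<omega> ` alcove"
proof -
  obtain d :: "'k \<Rightarrow> int" where d: "(\<Sum>i\<in>UNIV. d i) = 0"
    and close: "\<And>i j. \<bar>(y $ i - d i) - (y $ j - d j)\<bar> < 1"
    using unit_spread_translate[of "($) y" 0] y by auto
  define x where "x i = y $ i - d i" for i
  have "inj x"
  proof (rule injI, rule ccontr)
    fix i j assume "x i = x j" "i \<noteq> j"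
    then have "y $ i - y $ j = of_int (d i - d j)" by (simp add: x_def)
    then show False using y[OF \<open>i \<noteq> j\<close>] by (simp only: Ints_of_int not_True_eq_False)
  qed
  then obtain p where p: "p permutes UNIV" and sorted: "\<And>i j. i < j \<Longrightarrow> x (p j) < x (p i)"
    using sorting_permutation by blast
  define z :: "(real, 'k) vec" where "z = (\<chi> i. x (p i))"
  define v :: "(real, 'k) vec" where "v = (\<chi> i. of_int (d i))"
  have "z \<in> alcove"
    using sorted close[of "p (Min UNIV)" "p (Max UNIV)"] by (auto simp: alcove_def z_def x_def)
  moreover have "y = perm_map p z + v"
    by (simp add: vec_eq_iff perm_map_nth[OF p] z_def v_def x_def permutes_inverses[OF p])
  moreover have "v \<in> zero_sum_lattice"
    using d by (simp add: zero_sum_lattice_def v_def flip: of_int_sum)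
  then have "(\<lambda>y. perm_map p y + v) \<in> affine_weyl_group"
    using p by (auto simp: affine_weyl_group_def)
  ultimately show ?thesis by (intro bexI[of _ "\<lambda>y. perm_map p y + v"] image_eqI[of _ _ z])
qed

section \<open>Cardinality of the affine Weyl group\<close>

lemma countable_affine_weyl_group: "countable (affine_weyl_group :: (real ^ 'k::finite \<Rightarrow> real ^ 'k) set)"
proof (rule countable_subset)
  show "affine_weyl_group \<subseteq> (\<lambda>(p, d) y. perm_map p y + (\<chi> i. of_int (d i))) ` (UNIV :: (('k \<Rightarrow> 'k) \<times> ('k \<Rightarrow> int)) set)"
  proof
    fix \<omega> :: "real ^ 'k \<Rightarrow> real ^ 'k" assume "\<omega> \<in> affine_weyl_group"
    then obtain p d where d: "d \<in> zero_sum_lattice" and w: "\<omega> = (\<lambda>y. perm_map p y + d)"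
      by (auto simp: affine_weyl_group_def)
    have "d = (\<chi> i. of_int \<lfloor>d $ i\<rfloor>)" using d by (simp add: zero_sum_lattice_def vec_eq_iff)
    then show "\<omega> \<in> (\<lambda>(p, d) y. perm_map p y + (\<chi> i. of_int (d i))) ` UNIV"
      unfolding w by (intro image_eqI[of _ _ "(p, \<lambda>i. \<lfloor>d $ i\<rfloor>)"]) auto
  qed
qed auto

lemma infinite_zero_sum_lattice:
  assumes "CARD('k::finite) \<ge> 2"
  shows "infinite (zero_sum_lattice :: (real ^ 'k) set)"
proof -
  obtain a b :: 'k where ab: "a \<noteq> b"
    using assms by (metis (full_types) One_nat_def Suc_1 card_1_singletonE card_le_Suc0_iff_eq finite not_less_eq_eq UNIV_I)
  define g :: "nat \<Rightarrow> real ^ 'k" where "g n = axis a (real n) - axis b (real n)" for n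
  have "inj g"
  proof (rule injI)
    fix m n assume "g m = g n"
    then have "g m $ a = g n $ a" by simp
    then show "m = n" using ab by (simp add: g_def axis_def)
  qed
  moreover have "range g \<subseteq> zero_sum_lattice"
    by (auto simp: g_def zero_sum_lattice_def axis_def sum_subtractf)
  ultimately show ?thesis using finite_subset range_inj_infinite by blast
qed

text \<open>Together with countability this gives a bijective enumeration by the natural numbers,
  which turns the sum over the group into a series.\<close>

lemma infinite_affine_weyl_group:
  assumes "CARD('k::finite) \<ge> 2"
  shows "infinite (affine_weyl_group :: (real ^ 'k \<Rightarrow> real ^ 'k) set)"
proof -
  have "(\<lambda>d y. perm_map id y + d) ` zero_sum_lattice \<subseteq> (affine_weyl_group :: (real ^ 'k \<Rightarrow> real ^ 'k) set)"
    using permutes_id[of "UNIV :: 'k set"] unfolding affine_weyl_group_def by blast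
  moreover have "inj (\<lambda>d y. perm_map id y + d :: real ^ 'k)"
    by (rule injI) (simp add: fun_eq_iff)
  ultimately show ?thesis
    using infinite_zero_sum_lattice[OF assms] finite_subset finite_imageD inj_on_subset by (metis subset_UNIV)
qed

section \<open>Lebesgue measure: invariance under the group and product structure\<close>

lemma prod_Basis_vec: "(\<Prod>b\<in>(Basis :: (real ^ 'k) set). g b) = (\<Prod>i\<in>UNIV. g (axis i 1))"
proof -
  have "Basis = (\<lambda>i :: 'k. axis i (1 :: real)) ` UNIV" by (auto simp: Basis_vec_def)
  moreover have "inj (\<lambda>i :: 'k. axis i (1 :: real))" by (auto simp: inj_def axis_eq_axis)
  ultimately show ?thesis by (metis (no_types, lifting) prod.reindex_cong)
qed

lemma borel_measurable_perm_map: "perm_map p \<in> borel_measurable borel"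
  unfolding perm_map_def[abs_def] by (intro borel_measurable_continuous_onI continuous_intros)

text \<open>The preimage of a box is the box with permuted sides, of the same volume, and volumes of
  boxes determine the measure.\<close>

lemma lborel_distr_perm_map:
  fixes p :: "'k::finite \<Rightarrow> 'k"
  assumes p: "p permutes UNIV"
  shows "distr lborel borel (perm_map p) = lborel"
proof (rule lborel_eqI[symmetric])
  fix l u :: "real ^ 'k" assume lu: "\<And>b. b \<in> Basis \<Longrightarrow> l \<bullet> b \<le> u \<bullet> b"
  then have le: "l $ i \<le> u $ i" for i
    using lu[of "axis i 1"] by (simp add: inner_axis)
  have "perm_map p -` box l u = box (\<chi> i. l $ p i) (\<chi> i. u $ p i)"
  proof (intro set_eqI)
    fix y :: "real ^ 'k"
    have "(\<forall>j. l $ j < y $ inv p j \<and> y $ inv p j < u $ j) \<longleftrightarrow> (\<forall>i. l $ p i < y $ i \<and> y $ i < u $ p i)"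
      by (metis permutes_inverses[OF p])
    then show "y \<in> perm_map p -` box l u \<longleftrightarrow> y \<in> box (\<chi> i. l $ p i) (\<chi> i. u $ p i)"
      by (simp add: mem_box_cart perm_map_nth[OF p])
  qed
  moreover have "(\<chi> i. l $ p i) \<bullet> b \<le> (\<chi> i. u $ p i) \<bullet> b" if "b \<in> Basis" for b
    using that le by (auto simp: Basis_vec_def inner_axis)
  ultimately have "emeasure (distr lborel borel (perm_map p)) (box l u) = (\<Prod>i\<in>UNIV. u $ p i - l $ p i)"
    by (simp add: emeasure_distr borel_measurable_perm_map prod_Basis_vec inner_axis)
  also have "(\<Prod>i\<in>UNIV. u $ p i - l $ p i) = (\<Prod>i\<in>UNIV. u $ i - l $ i)"
    using prod.permute[OF p, of "\<lambda>i. u $ i - l $ i"] by (simp add: o_def)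
  finally show "emeasure (distr lborel borel (perm_map p)) (box l u) = (\<Prod>b\<in>Basis. (u - l) \<bullet> b)"
    by (simp add: prod_Basis_vec inner_axis)
qed simp

lemma borel_measurable_affine_weyl_group:
  "\<omega> \<in> affine_weyl_group \<Longrightarrow> \<omega> \<in> borel_measurable borel"
  by (auto simp: affine_weyl_group_def intro!: borel_measurable_add borel_measurable_perm_map)

lemma lborel_distr_affine_weyl_group:
  assumes "\<omega> \<in> affine_weyl_group"
  shows "distr lborel borel \<omega> = lborel"
proof -
  obtain p d where p: "p permutes UNIV" and w: "\<omega> = (+) d \<circ> perm_map p"
    using assms by (auto simp: affine_weyl_group_def o_def add.commute)
  have "distr lborel borel \<omega> = distr (distr lborel borel (perm_map p)) borel ((+) d)"
    unfolding w by (subst distr_distr) (auto simp: borel_measurable_perm_map)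
  then show ?thesis by (simp add: lborel_distr_perm_map[OF p] lborel_distr_plus)
qed

text \<open>Gives access to products over arbitrary subsets of the index set, so that coordinates
  can be grouped according to a partition.\<close>

lemma lborel_eq_distr_PiM:
  "lborel = distr (\<Pi>\<^sub>M i\<in>(UNIV :: 'k::finite set). lborel) borel (\<lambda>x. (\<chi> i. x i) :: real ^ 'k)"
proof (rule lborel_eqI)
  interpret product_sigma_finite "\<lambda>i :: 'k. lborel :: real measure" ..
  have meas: "(\<lambda>x. (\<chi> i. x i) :: real ^ 'k) \<in> borel_measurable (\<Pi>\<^sub>M i\<in>(UNIV :: 'k set). lborel)"
    by (subst borel_measurable_euclidean_space) (auto simp: Basis_vec_def inner_axis)
  fix l u :: "real ^ 'k" assume lu: "\<And>b. b \<in> Basis \<Longrightarrow> l \<bullet> b \<le> u \<bullet> b"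
  then have le: "l $ i \<le> u $ i" for i
    using lu[of "axis i 1"] by (simp add: inner_axis)
  have "(\<lambda>x. (\<chi> i. x i) :: real ^ 'k) -` box l u \<inter> space (\<Pi>\<^sub>M i\<in>(UNIV :: 'k set). lborel) = (\<Pi>\<^sub>E i\<in>UNIV. {l $ i<..<u $ i})"
    by (auto simp: mem_box_cart space_PiM PiE_def Pi_def)
  then show "emeasure (distr (\<Pi>\<^sub>M i\<in>(UNIV :: 'k set). lborel) borel (\<lambda>x. (\<chi> i. x i) :: real ^ 'k)) (box l u) = (\<Prod>b\<in>Basis. (u - l) \<bullet> b)"
    using le by (simp add: emeasure_distr meas emeasure_PiM prod_ennreal prod_Basis_vec inner_axis)
qed simp

section \<open>Integrals of products over blocks of coordinates\<close>

text \<open>Completeness of \<open>lebesgue\<close> supplies the measurability of \<open>F\<close>.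
  This is how integrands built from the \<open>f i\<close>, or from an infinite sum, are replaced by
  Borel ones.\<close>

lemma lebesgue_integral_AE_eq:
  fixes F G :: "'a::euclidean_space \<Rightarrow> real"
  assumes G: "G \<in> borel_measurable lborel" and ae: "AE x in lborel. F x = G x"
  shows "integral\<^sup>L lebesgue F = integral\<^sup>L lborel G"
proof -
  have ae': "AE x in lebesgue. G x = F x" using ae by (auto simp: AE_completion_iff)
  have "G \<in> borel_measurable lebesgue" using G by (rule measurable_completion)
  moreover from this have "F \<in> borel_measurable lebesgue" using ae' by (rule borel_measurable_AE)
  ultimately have "integral\<^sup>L lebesgue F = integral\<^sup>L lebesgue G"
    using ae' by (intro integral_cong_AE) auto
  then show ?thesis using G by (simp add: integral_completion)
qed

text \<open>The excluded set is a countable union of hyperplanes. Both the walls of the alcoves and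
  the jumps of \<open>floor_ceil (y - z)\<close> are of this form.\<close>

lemma AE_inner_not_int:
  fixes a :: "'a::euclidean_space"
  assumes "a \<noteq> 0"
  shows "AE x in lborel. a \<bullet> x \<notin> \<int>"
proof -
  have "AE x in lborel. a \<bullet> x \<noteq> of_int n" for n :: int
  proof -
    have "{x. a \<bullet> x = of_int n} \<in> null_sets lebesgue"
      using negligible_hyperplane[of a "of_int n"] assms by (simp add: negligible_iff_null_sets)
    then have "AE x in lebesgue. x \<notin> {x. a \<bullet> x = of_int n}" by (rule AE_not_in)
    then show ?thesis by (simp add: AE_completion_iff)
  qed
  then have "AE x in lborel. \<forall>n :: int. a \<bullet> x \<noteq> of_int n" by (simp add: AE_all_countable)
  then show ?thesis by eventually_elim (auto elim!: Ints_cases)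
qed

lemma (in pair_sigma_finite) integrable_mult_fst_snd:
  fixes u v :: "_ \<Rightarrow> real"
  assumes u: "integrable M1 u" and v: "integrable M2 v"
  shows "integrable (M1 \<Otimes>\<^sub>M M2) (\<lambda>p. u (fst p) * v (snd p))"
    and "(LINT p|(M1 \<Otimes>\<^sub>M M2). u (fst p) * v (snd p)) = integral\<^sup>L M1 u * integral\<^sup>L M2 v"
proof -
  have [measurable]: "u \<in> borel_measurable M1" "v \<in> borel_measurable M2" using u v by auto
  show int: "integrable (M1 \<Otimes>\<^sub>M M2) (\<lambda>p. u (fst p) * v (snd p))"
    using u v by (intro Fubini_integrable) (auto simp: abs_mult)
  show "(LINT p|(M1 \<Otimes>\<^sub>M M2). u (fst p) * v (snd p)) = integral\<^sup>L M1 u * integral\<^sup>L M2 v"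
    using integral_fst'[OF int] by simp
qed

context product_sigma_finite
begin

text \<open>\<open>merge I J\<close> carries the product of the two block measures to the measure on
  \<open>I \<union> J\<close>, and the restrictions undo it; what is left is Fubini for separated
  variables.\<close>

lemma integral_two_blocks:
  fixes u v :: "_ \<Rightarrow> real"
  assumes IJ: "I \<inter> J = {}" and fin: "finite I" "finite J"
    and u: "integrable (Pi\<^sub>M I M) u" and v: "integrable (Pi\<^sub>M J M) v"
  shows "integrable (Pi\<^sub>M (I \<union> J) M) (\<lambda>x. u (restrict x I) * v (restrict x J))"
    and "(LINT x|(Pi\<^sub>M (I \<union> J) M). u (restrict x I) * v (restrict x J)) = integral\<^sup>L (Pi\<^sub>M I M) u * integral\<^sup>L (Pi\<^sub>M J M) v"
proof -
  interpret pair_sigma_finite "Pi\<^sub>M I M" "Pi\<^sub>M J M"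
    by (intro pair_sigma_finite.intro sigma_finite fin)
  have [measurable]: "u \<in> borel_measurable (Pi\<^sub>M I M)" "v \<in> borel_measurable (Pi\<^sub>M J M)" using u v by auto
  let ?F = "\<lambda>x. u (restrict x I) * v (restrict x J)"
  have meas: "?F \<in> borel_measurable (Pi\<^sub>M (I \<union> J) M)"
    by (intro borel_measurable_times measurable_compose[OF measurable_restrict_subset]) auto
  have F: "?F (merge I J p) = u (fst p) * v (snd p)" if "p \<in> space (Pi\<^sub>M I M \<Otimes>\<^sub>M Pi\<^sub>M J M)" for p
    using that IJ by (cases p) (auto simp: space_pair_measure space_PiM PiE_def extensional_restrict)
  have "integrable (distr (Pi\<^sub>M I M \<Otimes>\<^sub>M Pi\<^sub>M J M) (Pi\<^sub>M (I \<union> J) M) (merge I J)) ?F"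
    unfolding integrable_distr_eq[OF measurable_merge meas]
    by (subst Bochner_Integration.integrable_cong[OF refl F]) (simp_all add: integrable_mult_fst_snd(1)[OF u v])
  then show "integrable (Pi\<^sub>M (I \<union> J) M) ?F"
    by (simp only: distr_merge[OF IJ fin])
  have "integral\<^sup>L (distr (Pi\<^sub>M I M \<Otimes>\<^sub>M Pi\<^sub>M J M) (Pi\<^sub>M (I \<union> J) M) (merge I J)) ?F = integral\<^sup>L (Pi\<^sub>M I M) u * integral\<^sup>L (Pi\<^sub>M J M) v"
    unfolding integral_distr[OF measurable_merge meas]
    by (subst Bochner_Integration.integral_cong[OF refl F]) (simp_all add: integrable_mult_fst_snd(2)[OF u v])
  then show "integral\<^sup>L (Pi\<^sub>M (I \<union> J) M) ?F = integral\<^sup>L (Pi\<^sub>M I M) u * integral\<^sup>L (Pi\<^sub>M J M) v"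
    by (simp only: distr_merge[OF IJ fin])
qed

lemma integral_blocks:
  fixes u :: "'i set \<Rightarrow> ('i \<Rightarrow> 'a) \<Rightarrow> real"
  assumes "finite \<pi>" "\<And>B. B \<in> \<pi> \<Longrightarrow> finite B" "disjoint \<pi>" "\<And>B. B \<in> \<pi> \<Longrightarrow> integrable (Pi\<^sub>M B M) (u B)"
  shows "integrable (Pi\<^sub>M (\<Union>\<pi>) M) (\<lambda>x. \<Prod>B\<in>\<pi>. u B (restrict x B)) \<and>
    (LINT x|(Pi\<^sub>M (\<Union>\<pi>) M). (\<Prod>B\<in>\<pi>. u B (restrict x B))) = (\<Prod>B\<in>\<pi>. integral\<^sup>L (Pi\<^sub>M B M) (u B))"
  using assms
proof (induction \<pi>)
  case empty
  show ?case using product_integrable_prod[of "{}" "\<lambda>_ _. 1 :: real"] product_integral_prod[of "{}" "\<lambda>_ _. 1 :: real"] by simp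
next
  case (insert B \<pi>)
  let ?v = "\<lambda>x. \<Prod>C\<in>\<pi>. u C (restrict x C)"
  have IH: "integrable (Pi\<^sub>M (\<Union>\<pi>) M) ?v" "integral\<^sup>L (Pi\<^sub>M (\<Union>\<pi>) M) ?v = (\<Prod>B\<in>\<pi>. integral\<^sup>L (Pi\<^sub>M B M) (u B))"
    using insert.IH insert.prems unfolding pairwise_insert by blast+
  have disj: "B \<inter> \<Union>\<pi> = {}" using insert.prems(2) insert.hyps(2) by (auto simp: disjoint_def)
  have fin: "finite B" "finite (\<Union>\<pi>)" using insert by auto
  have v: "?v (restrict x (\<Union>\<pi>)) = ?v x" for x
    by (intro prod.cong refl) (metis restrict_restrict Int_absorb1 Sup_upper)
  have uB: "integrable (Pi\<^sub>M B M) (u B)" using insert by auto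
  have "integrable (Pi\<^sub>M (B \<union> \<Union>\<pi>) M) (\<lambda>x. u B (restrict x B) * ?v x)"
    "(LINT x|(Pi\<^sub>M (B \<union> \<Union>\<pi>) M). u B (restrict x B) * ?v x) = integral\<^sup>L (Pi\<^sub>M B M) (u B) * integral\<^sup>L (Pi\<^sub>M (\<Union>\<pi>) M) ?v"
    using integral_two_blocks[OF disj fin uB IH(1)] unfolding v by blast+
  then show ?case
    unfolding Union_insert prod.insert[OF insert.hyps] IH(2) by blast
qed

text \<open>A box has preimage \<open>A i \<times> A j\<close>, which determines the measure. The
  first component always goes to \<open>i\<close>, so the orientation of a pair is kept.\<close>

lemma distr_pair_block:
  assumes "i \<noteq> j"
  shows "distr (M i \<Otimes>\<^sub>M M j) (Pi\<^sub>M {i, j} M) (\<lambda>(a, b). \<lambda>k\<in>{i, j}. if k = i then a else b) = Pi\<^sub>M {i, j} M"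
    and "(\<lambda>(a, b). \<lambda>k\<in>{i, j}. if k = i then a else b) \<in> M i \<Otimes>\<^sub>M M j \<rightarrow>\<^sub>M Pi\<^sub>M {i, j} M"
proof -
  let ?T = "\<lambda>(a, b). \<lambda>k\<in>{i, j}. if k = i then a else b"
  show meas: "?T \<in> M i \<Otimes>\<^sub>M M j \<rightarrow>\<^sub>M Pi\<^sub>M {i, j} M"
    unfolding case_prod_unfold using assms by (intro measurable_restrict) auto
  show "distr (M i \<Otimes>\<^sub>M M j) (Pi\<^sub>M {i, j} M) ?T = Pi\<^sub>M {i, j} M"
  proof (rule PiM_eqI)
    fix A assume A: "\<And>k. k \<in> {i, j} \<Longrightarrow> A k \<in> sets (M k)"
    have "?T -` Pi\<^sub>E {i, j} A \<inter> space (M i \<Otimes>\<^sub>M M j) = A i \<times> A j"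
      using assms A[THEN sets.sets_into_space] by (auto simp: space_pair_measure PiE_def Pi_def split: if_splits)
    moreover have "Pi\<^sub>E {i, j} A \<in> sets (Pi\<^sub>M {i, j} M)" using A by (intro sets_PiM_I_finite) auto
    ultimately show "emeasure (distr (M i \<Otimes>\<^sub>M M j) (Pi\<^sub>M {i, j} M) ?T) (Pi\<^sub>E {i, j} A) = (\<Prod>k\<in>{i, j}. emeasure (M k) (A k))"
      using A assms sigma_finite_measure.emeasure_pair_measure_Times[OF sigma_finite_measures, of "A i" "M i" "A j" j]
      by (simp add: emeasure_distr[OF meas])
  qed auto
qed

lemma integral_pair_block:
  fixes \<phi> :: "'a \<times> 'a \<Rightarrow> real"
  assumes ij: "i \<noteq> j" and \<phi>: "integrable (M i \<Otimes>\<^sub>M M j) \<phi>"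
  shows "integrable (Pi\<^sub>M {i, j} M) (\<lambda>x. \<phi> (x i, x j))"
    and "(LINT x|(Pi\<^sub>M {i, j} M). \<phi> (x i, x j)) = integral\<^sup>L (M i \<Otimes>\<^sub>M M j) \<phi>"
proof -
  let ?T = "\<lambda>(a, b). \<lambda>k\<in>{i, j}. if k = i then a else b"
  have [measurable]: "\<phi> \<in> borel_measurable (M i \<Otimes>\<^sub>M M j)" using \<phi> by auto
  have meas: "(\<lambda>x. \<phi> (x i, x j)) \<in> borel_measurable (Pi\<^sub>M {i, j} M)" by measurable
  have e: "(\<lambda>p. \<phi> (?T p i, ?T p j)) = \<phi>" using ij by (auto simp: fun_eq_iff)
  have "integrable (distr (M i \<Otimes>\<^sub>M M j) (Pi\<^sub>M {i, j} M) ?T) (\<lambda>x. \<phi> (x i, x j))"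
    unfolding integrable_distr_eq[OF distr_pair_block(2)[OF ij] meas] e by (rule \<phi>)
  then show "integrable (Pi\<^sub>M {i, j} M) (\<lambda>x. \<phi> (x i, x j))"
    unfolding distr_pair_block(1)[OF ij] .
  have "integral\<^sup>L (distr (M i \<Otimes>\<^sub>M M j) (Pi\<^sub>M {i, j} M) ?T) (\<lambda>x. \<phi> (x i, x j)) = integral\<^sup>L (M i \<Otimes>\<^sub>M M j) \<phi>"
    unfolding integral_distr[OF distr_pair_block(2)[OF ij] meas] e ..
  then show "(LINT x|(Pi\<^sub>M {i, j} M). \<phi> (x i, x j)) = integral\<^sup>L (M i \<Otimes>\<^sub>M M j) \<phi>"
    unfolding distr_pair_block(1)[OF ij] .
qed

end

lemma measurable_vec_lambda: "(\<lambda>x. (\<chi> i. x i) :: real ^ 'k) \<in> borel_measurable (\<Pi>\<^sub>M i\<in>(UNIV :: 'k::finite set). lborel)"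
  by (subst borel_measurable_euclidean_space) (auto simp: Basis_vec_def inner_axis)

lemma measurable_vec_nth [measurable]: "(\<lambda>y. y $ i) \<in> borel_measurable (borel :: (real ^ 'k::finite) measure)"
  by (intro borel_measurable_continuous_onI continuous_intros)

lemma integral_vec_blocks:
  fixes u :: "'k::finite set \<Rightarrow> ('k \<Rightarrow> real) \<Rightarrow> real"
  assumes \<pi>: "partition_on UNIV \<pi>" and u: "\<And>B. B \<in> \<pi> \<Longrightarrow> integrable (\<Pi>\<^sub>M i\<in>B. lborel) (u B)"
  shows "integrable lborel (\<lambda>y :: real ^ 'k. \<Prod>B\<in>\<pi>. u B (restrict (($) y) B))"
    and "(LINT y|lborel. (\<Prod>B\<in>\<pi>. u B (restrict (($) (y :: real ^ 'k)) B))) = (\<Prod>B\<in>\<pi>. LINT x|(\<Pi>\<^sub>M i\<in>B. lborel). u B x)"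
proof -
  interpret product_sigma_finite "\<lambda>i :: 'k. lborel :: real measure" ..
  let ?F = "\<lambda>y :: real ^ 'k. \<Prod>B\<in>\<pi>. u B (restrict (($) y) B)"
  have meas: "?F \<in> borel_measurable borel"
  proof (intro borel_measurable_prod)
    fix B assume "B \<in> \<pi>"
    have "(\<lambda>y :: real ^ 'k. \<lambda>i\<in>B. y $ i) \<in> borel \<rightarrow>\<^sub>M (\<Pi>\<^sub>M i\<in>B. lborel)"
      by (intro measurable_restrict) simp
    then have "(\<lambda>y :: real ^ 'k. u B (\<lambda>i\<in>B. y $ i)) \<in> borel_measurable borel"
      using u[OF \<open>B \<in> \<pi>\<close>] by (rule measurable_compose[OF _ borel_measurable_integrable])
    then show "(\<lambda>y :: real ^ 'k. u B (restrict (($) y) B)) \<in> borel_measurable borel" .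
  qed
  have fin: "finite \<pi>" "\<Union>\<pi> = UNIV" "disjoint \<pi>"
    using \<pi> by (auto simp: partition_on_def intro: finite_UnionD)
  have "($) (\<chi> i. x i) = x" for x :: "'k \<Rightarrow> real" by (simp add: fun_eq_iff)
  then have F: "?F (\<chi> i. x i) = (\<Prod>B\<in>\<pi>. u B (restrict x B))" for x
    by simp
  have P: "integrable (\<Pi>\<^sub>M i\<in>UNIV. lborel) (\<lambda>x. \<Prod>B\<in>\<pi>. u B (restrict x B))"
    "(LINT x|(\<Pi>\<^sub>M i\<in>UNIV. lborel). (\<Prod>B\<in>\<pi>. u B (restrict x B))) = (\<Prod>B\<in>\<pi>. LINT x|(\<Pi>\<^sub>M i\<in>B. lborel). u B x)"
    using integral_blocks[OF fin(1) _ fin(3), of u] u unfolding fin(2) by auto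
  show "integrable lborel ?F"
    unfolding lborel_eq_distr_PiM using P(1)
    by (subst integrable_distr_eq[OF measurable_vec_lambda]) (auto simp: F meas)
  show "integral\<^sup>L lborel ?F = (\<Prod>B\<in>\<pi>. LINT x|(\<Pi>\<^sub>M i\<in>B. lborel). u B x)"
    unfolding lborel_eq_distr_PiM using P(2)
    by (subst integral_distr[OF measurable_vec_lambda]) (auto simp: F meas)
qed

text \<open>Adding the singleton block \<open>{l}\<close> makes \<open>\<pi>\<close> a partition of
  all indices. Each factor \<open>g i\<close> is absorbed into the block of \<open>i\<close>, and
  the integral factors over blocks.\<close>

lemma integral_pair_partition:
  fixes g :: "'k::{finite,linorder} \<Rightarrow> real \<Rightarrow> real"
  assumes g: "\<And>i. integrable lborel (g i)" and \<pi>: "\<pi> \<in> pair_partitions (UNIV - {l})"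
    and H: "\<And>i j. i \<noteq> j \<Longrightarrow> integrable lborel (\<lambda>(y, z). c (y - z) * g i y * g j z)"
  shows "integrable lborel (\<lambda>y :: (real, 'k) vec. (\<Prod>B\<in>\<pi>. c (y $ Min B - y $ Max B)) * (\<Prod>i\<in>UNIV. g i (y $ i)))"
    and "(LINT y|lborel. (\<Prod>B\<in>\<pi>. c (y $ Min B - y $ Max B)) * (\<Prod>i\<in>UNIV. g i ((y :: (real, 'k) vec) $ i))) =
      (LINT x|lborel. g l x) * (\<Prod>B\<in>\<pi>. LINT (y, z)|lborel. c (y - z) * g (Min B) y * g (Max B) z)"
proof -
  interpret product_sigma_finite "\<lambda>i :: 'k. lborel :: real measure" ..
  define \<phi> where "\<phi> B = (\<lambda>(y, z). c (y - z) * g (Min B) y * g (Max B) z)" for B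
  define u where "u B = (if B = {l} then (\<lambda>x. g l (x l)) else (\<lambda>x. \<phi> B (x (Min B), x (Max B))))" for B
  have l: "{l} \<notin> \<pi>" using pair_partitionsD(3)[OF \<pi>] by auto
  have fin: "finite \<pi>" using finite_pair_partition[OF \<pi>] by auto
  have MM: "B = {Min B, Max B}" "Min B \<noteq> Max B" if "B \<in> \<pi>" for B
    using card_2_MinMax[OF pair_partitionsD(2)[OF \<pi> that]] by auto
  have part: "partition_on UNIV (insert {l} \<pi>)"
    using \<pi> l by (auto simp: pair_partitions_def partition_on_def disjoint_def)
  have ul: "u {l} = (\<lambda>x. g l (x l))" by (simp add: u_def)
  have uB: "u B = (\<lambda>x. \<phi> B (x (Min B), x (Max B)))" if "B \<in> \<pi>" for B
    using l that by (auto simp: u_def)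
  have \<phi>: "integrable (lborel \<Otimes>\<^sub>M lborel) (\<phi> B)" if "B \<in> \<pi>" for B
    unfolding lborel_prod \<phi>_def by (rule H[OF MM(2)[OF that]])
  have int_u: "integrable (\<Pi>\<^sub>M i\<in>B. lborel) (u B)" "B \<in> \<pi> \<Longrightarrow> (LINT x|(\<Pi>\<^sub>M i\<in>B. lborel). u B x) = integral\<^sup>L lborel (\<phi> B)"
    if "B \<in> insert {l} \<pi>" for B
  proof -
    have 1: "integrable (\<Pi>\<^sub>M i\<in>{Min B, Max B}. lborel) (\<lambda>x. \<phi> B (x (Min B), x (Max B)))"
      "(LINT x|(\<Pi>\<^sub>M i\<in>{Min B, Max B}. lborel). \<phi> B (x (Min B), x (Max B))) = integral\<^sup>L lborel (\<phi> B)" if "B \<in> \<pi>"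
      using integral_pair_block[OF MM(2)[OF that] \<phi>[OF that]] by (simp_all add: lborel_prod)
    show "integrable (\<Pi>\<^sub>M i\<in>B. lborel) (u B)"
    proof (cases "B \<in> \<pi>")
      case True
      then show ?thesis unfolding uB[OF True] using 1(1) MM(1)[OF True] by simp
    next
      case False
      then have "B = {l}" using that by auto
      then show ?thesis using product_integrable_prod[of "{l}" g] g by (simp add: ul)
    qed
    show "(LINT x|(\<Pi>\<^sub>M i\<in>B. lborel). u B x) = integral\<^sup>L lborel (\<phi> B)" if "B \<in> \<pi>"
      unfolding uB[OF that] using 1(2)[OF that] MM(1)[OF that] by simp
  qed
  have int_l: "(LINT x|(\<Pi>\<^sub>M i\<in>{l}. lborel). u {l} x) = integral\<^sup>L lborel (g l)"
    using product_integral_prod[of "{l}" g] g by (simp add: ul)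
  have e: "(\<Prod>B\<in>insert {l} \<pi>. u B (restrict (($) y) B)) = (\<Prod>B\<in>\<pi>. c (y $ Min B - y $ Max B)) * (\<Prod>i\<in>UNIV. g i (y $ i))"
    for y :: "(real, 'k) vec"
  proof -
    have "(\<Prod>i\<in>UNIV. g i (y $ i)) = g l (y $ l) * (\<Prod>i\<in>\<Union>\<pi>. g i (y $ i))"
      unfolding pair_partitionsD(1)[OF \<pi>] by (simp add: prod.remove[of UNIV l])
    also have "(\<Prod>i\<in>\<Union>\<pi>. g i (y $ i)) = (\<Prod>B\<in>\<pi>. \<Prod>i\<in>B. g i (y $ i))"
      using pair_partitionsD(4)[OF \<pi>] by (subst prod.Union_disjoint) (auto simp: disjoint_def)
    also have "\<dots> = (\<Prod>B\<in>\<pi>. g (Min B) (y $ Min B) * g (Max B) (y $ Max B))"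
    proof (rule prod.cong)
      fix B assume "B \<in> \<pi>"
      have "(\<Prod>i\<in>{Min B, Max B}. g i (y $ i)) = g (Min B) (y $ Min B) * g (Max B) (y $ Max B)"
        using MM(2)[OF \<open>B \<in> \<pi>\<close>] by simp
      then show "(\<Prod>i\<in>B. g i (y $ i)) = g (Min B) (y $ Min B) * g (Max B) (y $ Max B)"
        using MM(1)[OF \<open>B \<in> \<pi>\<close>] by simp
    qed simp
    finally have "(\<Prod>i\<in>UNIV. g i (y $ i)) = g l (y $ l) * (\<Prod>B\<in>\<pi>. g (Min B) (y $ Min B) * g (Max B) (y $ Max B))" .
    moreover have "u B (restrict (($) y) B) = c (y $ Min B - y $ Max B) * (g (Min B) (y $ Min B) * g (Max B) (y $ Max B))"
      if "B \<in> \<pi>" for B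
    proof -
      have "Min B \<in> B" "Max B \<in> B" using MM(1)[OF that] by blast+
      then show ?thesis by (simp add: uB[OF that] \<phi>_def)
    qed
    ultimately show ?thesis using fin l by (simp add: ul prod.distrib)
  qed
  show "integrable lborel (\<lambda>y :: (real, 'k) vec. (\<Prod>B\<in>\<pi>. c (y $ Min B - y $ Max B)) * (\<Prod>i\<in>UNIV. g i (y $ i)))"
    using integral_vec_blocks(1)[OF part, of u] int_u(1) unfolding e by blast
  have "(LINT y|lborel. (\<Prod>B\<in>\<pi>. c (y $ Min B - y $ Max B)) * (\<Prod>i\<in>UNIV. g i ((y :: (real, 'k) vec) $ i))) =
    (\<Prod>B\<in>insert {l} \<pi>. LINT x|(\<Pi>\<^sub>M i\<in>B. lborel). u B x)"
    using integral_vec_blocks(2)[OF part, of u] int_u(1) unfolding e by blast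
  also have "\<dots> = integral\<^sup>L lborel (g l) * (\<Prod>B\<in>\<pi>. integral\<^sup>L lborel (\<phi> B))"
    using fin l by (simp add: int_l int_u(2))
  finally show "(LINT y|lborel. (\<Prod>B\<in>\<pi>. c (y $ Min B - y $ Max B)) * (\<Prod>i\<in>UNIV. g i ((y :: (real, 'k) vec) $ i))) =
      (LINT x|lborel. g l x) * (\<Prod>B\<in>\<pi>. LINT (y, z)|lborel. c (y - z) * g (Min B) y * g (Max B) z)"
    unfolding \<phi>_def .
qed

section \<open>The matrix entries and the tiling by alcoves\<close>

text \<open>Tonelli bounds the absolute series in L^1, which yields absolute convergence almost
  everywhere and termwise integration. It serves both the series in the matrix entries and the sum
  over the group.\<close>

lemma suminf_nn_integral_finite:
  fixes f :: "nat \<Rightarrow> 'a \<Rightarrow> real"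
  assumes meas [measurable]: "\<And>n. f n \<in> borel_measurable M"
    and fin: "(\<Sum>n. \<integral>\<^sup>+ x. ennreal \<bar>f n x\<bar> \<partial>M) < \<infinity>"
  shows "integrable M (f n)"
    and "AE x in M. summable (\<lambda>n. \<bar>f n x\<bar>)"
    and "integrable M (\<lambda>x. \<Sum>n. f n x)"
    and "(LINT x|M. (\<Sum>n. f n x)) = (\<Sum>n. LINT x|M. f n x)"
proof -
  show int: "integrable M (f n)" for n
    using ennreal_suminf_lessD[OF fin, of n] by (intro integrableI_bounded) auto
  have "(\<integral>\<^sup>+ x. (\<Sum>n. ennreal \<bar>f n x\<bar>) \<partial>M) \<noteq> \<infinity>"
    using fin by (simp add: nn_integral_suminf)
  then have "AE x in M. (\<Sum>n. ennreal \<bar>f n x\<bar>) \<noteq> \<infinity>"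
    by (intro nn_integral_PInf_AE) auto
  then show ae: "AE x in M. summable (\<lambda>n. \<bar>f n x\<bar>)"
    by eventually_elim (intro summable_suminf_not_top, auto)
  have "ennreal (LINT x|M. norm (f n x)) = (\<integral>\<^sup>+ x. ennreal \<bar>f n x\<bar> \<partial>M)" for n
    using int[of n] by (simp add: nn_integral_eq_integral)
  then have "summable (\<lambda>n. LINT x|M. norm (f n x))"
    using fin by (intro summable_suminf_not_top) auto
  with int ae show "integrable M (\<lambda>x. \<Sum>n. f n x)" "(LINT x|M. (\<Sum>n. f n x)) = (\<Sum>n. LINT x|M. f n x)"
    by (auto intro!: integrable_suminf integral_suminf)
qed

lemma sets_far_apart [measurable]: "far_apart m \<in> sets borel"
proof -
  have "far_apart m = {p. fst p - snd p < - real m} \<union> {p. real m < fst p - snd p}"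
    by (auto simp: far_apart_def)
  moreover have "open ({p :: real \<times> real. fst p - snd p < - real m} \<union> {p. real m < fst p - snd p})"
    by (intro open_Un open_Collect_less continuous_intros)
  ultimately show ?thesis by simp
qed

lemma floor_ceil_measurable [measurable]: "floor_ceil \<in> borel_measurable borel"
  unfolding floor_ceil_def[abs_def] by measurable

text \<open>For positive non-integral \<open>x\<close>, exactly \<open>\<lfloor>x\<rfloor>\<close>
  numbers m >= 1 lie below \<open>x\<close>, and the ceiling exceeds the floor by 1. Negative
  \<open>x\<close> follow because both sides are odd.\<close>

lemma floor_ceil_eq_sgn_series:
  assumes "x \<notin> \<int>"
  shows "floor_ceil x = sgn x + 2 * (\<Sum>m. if real (Suc m) < \<bar>x\<bar> then sgn x else 0)"
proof -
  have pos: "floor_ceil x = sgn x + 2 * (\<Sum>m. if real (Suc m) < \<bar>x\<bar> then sgn x else 0)"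
    if "x > 0" "x \<notin> \<int>" for x :: real
  proof -
    have frac: "of_int \<lfloor>x\<rfloor> < x"
      using that(2) by (metis Ints_of_int of_int_floor_le order_less_le)
    \<comment> \<open>The index \<open>m\<close> stands for the number m + 1, so the admissible
      indices start at 0 and stop just before the floor.\<close>
    have S: "{m. real (Suc m) < \<bar>x\<bar>} = {..<nat \<lfloor>x\<rfloor>}"
    proof (intro set_eqI)
      fix m
      have "x \<noteq> real (Suc m)" using that(2) by (metis Ints_of_nat)
      then have "real (Suc m) < x \<longleftrightarrow> int (Suc m) \<le> \<lfloor>x\<rfloor>"
        unfolding le_floor_iff of_int_of_nat_eq by linarith
      then show "m \<in> {m. real (Suc m) < \<bar>x\<bar>} \<longleftrightarrow> m \<in> {..<nat \<lfloor>x\<rfloor>}"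
        using that(1) by auto
    qed
    have "(\<Sum>m. if real (Suc m) < \<bar>x\<bar> then sgn x else 0) = (\<Sum>m | real (Suc m) < \<bar>x\<bar>. sgn x)"
      by (rule sums_unique[OF sums_If_finite, symmetric]) (simp only: S finite_lessThan)
    also have "\<dots> = of_int \<lfloor>x\<rfloor>"
      unfolding S using that(1) by simp
    finally have "(\<Sum>m. if real (Suc m) < \<bar>x\<bar> then sgn x else 0) = of_int \<lfloor>x\<rfloor>" .
    moreover have "\<lceil>x\<rceil> = \<lfloor>x\<rfloor> + 1" using frac by (simp add: ceiling_altdef)
    ultimately show ?thesis using that(1) by (simp add: floor_ceil_def)
  qed
  show ?thesis
  proof (cases "x > 0")
    case False
    then have "x < 0" using assms by (metis Ints_0 linorder_neqE_linordered_idom)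
    have "(\<Sum>m. if real (Suc m) < \<bar>- x\<bar> then sgn (- x) else 0) = (\<Sum>m. - (if real (Suc m) < \<bar>x\<bar> then sgn x else 0))"
      by (intro suminf_cong) (simp add: sgn_minus)
    also have "\<dots> = - (\<Sum>m. if real (Suc m) < \<bar>x\<bar> then sgn x else 0)"
    proof (rule suminf_minus[OF summable_finite])
      show "finite {..nat \<lceil>\<bar>x\<bar>\<rceil>}" by simp
    next
      fix m assume "m \<notin> {..nat \<lceil>\<bar>x\<bar>\<rceil>}"
      then show "(if real (Suc m) < \<bar>x\<bar> then sgn x else 0) = 0" by (auto simp: sgn_if) linarith+
    qed
    finally show ?thesis
      using pos[of "- x"] \<open>x < 0\<close> assms floor_ceil_minus[of x] by (simp add: sgn_minus minus_in_Ints_iff)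
  qed (use pos assms in blast)
qed

lemma indicator_far_apart: "indicator (far_apart m) (y, z) = (if real m < \<bar>y - z\<bar> then 1 else 0 :: real)"
  by (auto simp: far_apart_def indicator_def)

text \<open>The hypothesis \<open>fin\<close> dominates the L^1 norms of the terms of the sign
  series, so the unbounded kernel is integrable against \<open>g\<close> and \<open>h\<close>, and
  series and integral may be exchanged.\<close>

lemma H_entry_borel:
  fixes g h :: "real \<Rightarrow> real"
  assumes g: "integrable lborel g" and h: "integrable lborel h"
    and fin: "(\<Sum>m. \<integral>\<^sup>+ (y, z)\<in>far_apart (Suc m). ennreal \<bar>g y * h z\<bar> \<partial>lborel) < \<infinity>"
  shows "integrable lborel (\<lambda>(y, z). floor_ceil (y - z) * g y * h z)"
    and "(LINT (y, z)|lborel. floor_ceil (y - z) * g y * h z) =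
     (LINT (y, z)|lborel. sgn (y - z) * g y * h z) +
     2 * (\<Sum>m. LINT (y, z):far_apart (Suc m)|lborel. sgn (y - z) * g y * h z)"
proof -
  have psf: "pair_sigma_finite (lborel :: real measure) (lborel :: real measure)" ..
  have [measurable]: "g \<in> borel_measurable borel" "h \<in> borel_measurable borel" using g h by auto
  define k where "k = (\<lambda>(y, z). g y * h z)"
  define s where "s = (\<lambda>(y, z). sgn (y - z) * g y * h z)"
  define a where "a m p = indicator (far_apart (Suc m)) p *\<^sub>R s p" for m p
  have k: "integrable lborel k"
    using pair_sigma_finite.integrable_mult_fst_snd(1)[OF psf g h] by (simp add: lborel_prod k_def case_prod_unfold)
  have [measurable]: "s \<in> borel_measurable borel"
    unfolding s_def borel_prod[symmetric] by measurable
  have [measurable]: "a m \<in> borel_measurable lborel" for m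
    unfolding a_def by measurable
  have s: "integrable lborel s"
    by (rule Bochner_Integration.integrable_bound[OF k]) (measurable, auto simp: s_def k_def abs_mult sgn_if)
  have "(\<integral>\<^sup>+ p. ennreal \<bar>a m p\<bar> \<partial>lborel) \<le> (\<integral>\<^sup>+ (y, z)\<in>far_apart (Suc m). ennreal \<bar>g y * h z\<bar> \<partial>lborel)" for m
    by (intro nn_integral_mono) (auto simp: a_def s_def abs_mult sgn_if indicator_def)
  then have "(\<Sum>m. \<integral>\<^sup>+ p. ennreal \<bar>a m p\<bar> \<partial>lborel) \<le> (\<Sum>m. \<integral>\<^sup>+ (y, z)\<in>far_apart (Suc m). ennreal \<bar>g y * h z\<bar> \<partial>lborel)"
    by (intro suminf_le summableI)
  then have "(\<Sum>m. \<integral>\<^sup>+ p. ennreal \<bar>a m p\<bar> \<partial>lborel) < \<infinity>"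
    using fin by (rule le_less_trans)
  note a = suminf_nn_integral_finite[OF _ this, simplified]
  have "AE p in lborel. (1, -1 :: real) \<bullet> (p :: real \<times> real) \<notin> \<int>"
    by (rule AE_inner_not_int) (simp add: zero_prod_def)
  then have ae: "AE p in lborel. (case p of (y, z) \<Rightarrow> floor_ceil (y - z) * g y * h z) = s p + 2 * (\<Sum>m. a m p)"
  proof eventually_elim
    fix p :: "real \<times> real" assume p: "(1, -1) \<bullet> p \<notin> \<int>"
    obtain y z where yz: "p = (y, z)" by fastforce
    let ?r = "\<lambda>m. if real (Suc m) < \<bar>y - z\<bar> then sgn (y - z) else 0"
    have "summable ?r"
    proof (rule summable_finite)
      show "finite {..nat \<lceil>\<bar>y - z\<bar>\<rceil>}" by simp
    next
      fix m assume "m \<notin> {..nat \<lceil>\<bar>y - z\<bar>\<rceil>}"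
      then show "?r m = 0" by (auto simp: sgn_if) linarith+
    qed
    then have "(\<Sum>m. ?r m * (g y * h z)) = (\<Sum>m. ?r m) * (g y * h z)"
      by (rule suminf_mult2[symmetric])
    moreover have "a m p = ?r m * (g y * h z)" for m
      by (simp add: a_def s_def yz indicator_far_apart)
    ultimately show "(case p of (y, z) \<Rightarrow> floor_ceil (y - z) * g y * h z) = s p + 2 * (\<Sum>m. a m p)"
      using floor_ceil_eq_sgn_series[of "y - z"] p by (simp add: yz s_def algebra_simps)
  qed
  have meas: "(\<lambda>(y, z). floor_ceil (y - z) * g y * h z) \<in> borel_measurable lborel"
    unfolding measurable_lborel2 borel_prod[symmetric] by measurable
  have int: "integrable lborel (\<lambda>p. s p + 2 * (\<Sum>m. a m p))"
    using s a(3) by simp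
  show "integrable lborel (\<lambda>(y, z). floor_ceil (y - z) * g y * h z)"
    using ae int meas by (subst integrable_cong_AE) (auto intro: borel_measurable_integrable)
  have "(LINT (y, z)|lborel. floor_ceil (y - z) * g y * h z) = (LINT p|lborel. s p + 2 * (\<Sum>m. a m p))"
    using ae int meas by (intro integral_cong_AE) (auto intro: borel_measurable_integrable)
  also have "\<dots> = (LINT p|lborel. s p) + 2 * (\<Sum>m. LINT p|lborel. a m p)"
    using s a(3,4) by simp
  finally show "(LINT (y, z)|lborel. floor_ceil (y - z) * g y * h z) =
     (LINT (y, z)|lborel. sgn (y - z) * g y * h z) +
     2 * (\<Sum>m. LINT (y, z):far_apart (Suc m)|lborel. sgn (y - z) * g y * h z)"
    by (simp add: set_lebesgue_integral_def a_def s_def)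
qed

lemma AE_lborel_pair:
  fixes P Q :: "real \<Rightarrow> bool"
  assumes "AE x in lborel. P x" "AE x in lborel. Q x"
  shows "AE p in lborel. P (fst p) \<and> Q (snd p)"
proof -
  obtain N where N: "{x. \<not> P x} \<subseteq> N" "N \<in> null_sets lborel"
    using assms(1) by (auto simp: eventually_ae_filter)
  obtain N' where N': "{x. \<not> Q x} \<subseteq> N'" "N' \<in> null_sets lborel"
    using assms(2) by (auto simp: eventually_ae_filter)
  have "N \<times> UNIV \<in> null_sets (lborel :: (real \<times> real) measure)"
    using N(2) unfolding lborel_prod[symmetric] null_sets_def
    by (auto simp: lborel.emeasure_pair_measure_Times)
  moreover have "UNIV \<times> N' \<in> null_sets (lborel :: (real \<times> real) measure)"
    using N'(2) unfolding lborel_prod[symmetric] null_sets_def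
    by (auto simp: lborel.emeasure_pair_measure_Times)
  ultimately have "N \<times> UNIV \<union> UNIV \<times> N' \<in> null_sets (lborel :: (real \<times> real) measure)" by auto
  then show ?thesis
    by (rule AE_I') (use N(1) N'(1) in \<open>auto simp: subset_eq\<close>)
qed

text \<open>Changing the functions on null sets of the line alters the integrands only on null
  strips of the plane, so both the finiteness condition and the entry pass to the Borel
  representatives.\<close>

lemma H_entry_eq:
  fixes f g :: "real \<Rightarrow> real"
  assumes f: "AE x in lborel. f x = f' x" and g: "AE x in lborel. g x = g' x"
    and f': "integrable lborel f'" and g': "integrable lborel g'"
    and fin: "(\<Sum>m. \<integral>\<^sup>+ (y, z)\<in>far_apart (Suc m). ennreal \<bar>f y * g z\<bar> \<partial>lebesgue) < \<infinity>"
  shows "integrable lborel (\<lambda>(y, z). floor_ceil (y - z) * f' y * g' z)"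
    and "H_entry f g = (LINT (y, z)|lborel. floor_ceil (y - z) * f' y * g' z)"
proof -
  have [measurable]: "f' \<in> borel_measurable borel" "g' \<in> borel_measurable borel" using f' g' by auto
  have ae: "AE p in lborel. f (fst p) = f' (fst p) \<and> g (snd p) = g' (snd p)"
    by (rule AE_lborel_pair[OF f g])
  have "(\<integral>\<^sup>+ (y, z)\<in>far_apart (Suc m). ennreal \<bar>f y * g z\<bar> \<partial>lebesgue) =
    (\<integral>\<^sup>+ (y, z)\<in>far_apart (Suc m). ennreal \<bar>f' y * g' z\<bar> \<partial>lborel)" for m
    unfolding nn_integral_completion
    by (rule nn_integral_cong_AE) (use ae in eventually_elim, auto)
  then have fin': "(\<Sum>m. \<integral>\<^sup>+ (y, z)\<in>far_apart (Suc m). ennreal \<bar>f' y * g' z\<bar> \<partial>lborel) < \<infinity>"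
    using fin by simp
  show "integrable lborel (\<lambda>(y, z). floor_ceil (y - z) * f' y * g' z)"
    by (rule H_entry_borel(1)[OF f' g' fin'])
  have meas: "(\<lambda>(y, z). sgn (y - z) * f' y * g' z) \<in> borel_measurable borel"
    unfolding borel_prod[symmetric] by measurable
  have 1: "(LINT (y, z)|lebesgue. sgn (y - z) * f y * g z) = (LINT (y, z)|lborel. sgn (y - z) * f' y * g' z)"
    by (rule lebesgue_integral_AE_eq) (use meas ae in \<open>auto simp: case_prod_unfold\<close>)
  have 2: "(LINT (y, z):far_apart m|lebesgue. sgn (y - z) * f y * g z) = (LINT (y, z):far_apart m|lborel. sgn (y - z) * f' y * g' z)" for m
    unfolding set_lebesgue_integral_def
  proof (rule lebesgue_integral_AE_eq)
    show "(\<lambda>p. indicat_real (far_apart m) p *\<^sub>R (case p of (y, z) \<Rightarrow> sgn (y - z) * f' y * g' z)) \<in> borel_measurable lborel"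
      using meas by measurable
    show "AE p in lborel. indicat_real (far_apart m) p *\<^sub>R (case p of (y, z) \<Rightarrow> sgn (y - z) * f y * g z) =
      indicat_real (far_apart m) p *\<^sub>R (case p of (y, z) \<Rightarrow> sgn (y - z) * f' y * g' z)"
      using ae by eventually_elim (simp add: case_prod_unfold)
  qed
  show "H_entry f g = (LINT (y, z)|lborel. floor_ceil (y - z) * f' y * g' z)"
    unfolding H_entry_def 1 2 by (rule H_entry_borel(2)[OF f' g' fin', symmetric])
qed

lemma AE_lborel_nth:
  fixes P :: "real \<Rightarrow> bool"
  assumes "AE x in lborel. P x"
  shows "AE y in lborel. P ((y :: real ^ 'k::finite) $ i)"
proof -
  interpret product_sigma_finite "\<lambda>i :: 'k. lborel :: real measure" ..
  obtain N where N: "{x. \<not> P x} \<subseteq> N" "N \<in> null_sets lborel"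
    using assms by (auto simp: eventually_ae_filter)
  have N_sets: "N \<in> sets borel" using N(2) by auto
  let ?A = "(\<lambda>y :: real ^ 'k. y $ i) -` N"
  have A: "?A \<in> sets borel" using measurable_sets[OF measurable_vec_nth N_sets, of i] by simp
  have "(\<lambda>x. (\<chi> i. x i) :: real ^ 'k) -` ?A \<inter> space (\<Pi>\<^sub>M i\<in>UNIV. lborel) = (\<Pi>\<^sub>E j\<in>UNIV. if j = i then N else UNIV)"
    by (auto simp: space_PiM PiE_def Pi_def split: if_splits)
  then have "emeasure lborel ?A = (\<Prod>j\<in>UNIV. emeasure lborel (if j = i then N else UNIV))"
    unfolding lborel_eq_distr_PiM using N_sets A
    by (simp add: emeasure_distr measurable_vec_lambda emeasure_PiM)
  \<comment> \<open>The other factors are infinite, but in \<open>ennreal\<close> a product with a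
    zero factor is zero.\<close>
  also have "\<dots> = 0"
    by (rule prod_zero[OF finite]) (use N(2) in \<open>auto intro!: bexI[of _ i]\<close>)
  finally have "?A \<in> null_sets lborel" using A by auto
  then show ?thesis by (rule AE_I') (use N(1) in auto)
qed

section \<open>Integration over the tiling\<close>

lemma sets_alcove [measurable]: "alcove \<in> sets (borel :: (real ^ 'k::{finite,linorder}) measure)"
proof -
  have "Measurable.pred borel (\<lambda>y :: (real, 'k) vec. (\<forall>i j. i < j \<longrightarrow> y $ i > y $ j) \<and> 1 + y $ Max UNIV > y $ Min UNIV)"
    by measurable
  then show ?thesis by (simp add: alcove_def pred_def)
qed

lemma sets_image_affine_weyl_group:
  fixes A :: "(real ^ 'k::finite) set"
  assumes \<omega>: "\<omega> \<in> affine_weyl_group" and A: "A \<in> sets borel"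
  shows "\<omega> ` A \<in> sets borel" "inj \<omega>"
proof -
  obtain p d where p: "p permutes UNIV" and w: "\<omega> = (\<lambda>y. perm_map p y + d)"
    using \<omega> by (auto simp: affine_weyl_group_def)
  let ?v = "\<lambda>x. perm_map (inv p) (x - d)"
  have v: "?v (\<omega> y) = y" "\<omega> (?v y) = y" for y
    by (simp_all add: w vec_eq_iff perm_map_nth[OF p] perm_map_nth[OF permutes_inv[OF p]] permutes_inverses[OF p] permutes_inv_inv[OF p])
  then have "\<omega> ` A = ?v -` A" by (auto simp: image_iff) metis
  moreover have "?v \<in> borel_measurable borel"
    by (rule measurable_compose[OF _ borel_measurable_perm_map]) simp
  ultimately show "\<omega> ` A \<in> sets borel"
    using A measurable_sets[of ?v borel borel A] by simp
  show "inj \<omega>" using v(1) by (rule inj_on_inverseI)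
qed

text \<open>On the alcove, each term of the group sum is \<open>F\<close> pulled back from one tile
  by a measure-preserving map, so its integral is that of \<open>F\<close> over the tile. The tiles
  are disjoint and cover almost everything, so these integrals add up to that of \<open>F\<close>.
  The function \<open>S\<close> is a measurable stand-in for the unordered sum.\<close>

lemma alcove_tiling:
  fixes F :: "real ^ 'k::{finite,linorder} \<Rightarrow> real"
  assumes k: "CARD('k) \<ge> 2" and F: "integrable lborel F"
  obtains S where "S \<in> borel_measurable lborel"
    and "AE y in lborel. indicator alcove y *\<^sub>R (\<Sum>\<^sub>\<infinity>\<omega>\<in>affine_weyl_group. F (\<omega> y)) = S y"
    and "integral\<^sup>L lborel S = integral\<^sup>L lborel F"
proof -
  let ?W = "affine_weyl_group :: ((real, 'k) vec \<Rightarrow> (real, 'k) vec) set"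
  define e where "e = from_nat_into ?W"
  have bij: "bij_betw e UNIV ?W"
    unfolding e_def by (intro bij_betw_from_nat_into countable_affine_weyl_group infinite_affine_weyl_group k)
  have eW: "e n \<in> ?W" for n using bij by (auto simp: bij_betw_def)
  have [measurable]: "F \<in> borel_measurable borel" using F by auto
  have [measurable]: "e n \<in> borel_measurable borel" for n by (rule borel_measurable_affine_weyl_group[OF eW])
  have [measurable]: "e n ` alcove \<in> sets borel" for n by (rule sets_image_affine_weyl_group[OF eW]) simp
  have inj: "inj (e n)" for n by (rule sets_image_affine_weyl_group(2)[OF eW sets.empty_sets])
  define a where "a n y = indicator alcove y *\<^sub>R F (e n y)" for n y
  define b where "b n y = indicator (e n ` alcove) y *\<^sub>R F y" for n y
  have [measurable]: "a n \<in> borel_measurable borel" "b n \<in> borel_measurable borel" for n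
    unfolding a_def b_def by measurable
  have ab: "a n y = b n (e n y)" for n y
    using inj[of n] by (auto simp: a_def b_def indicator_def inj_def)
  have disj: "disjoint_family (\<lambda>n. e n ` alcove)"
  proof (unfold disjoint_family_on_def, intro ballI impI)
    fix m n :: nat assume "m \<noteq> n"
    then have "e m \<noteq> e n" using bij by (auto simp: bij_betw_def inj_def)
    then show "e m ` alcove \<inter> e n ` alcove = {}" using alcove_disjoint[OF eW eW] by blast
  qed
  \<comment> \<open>At most one tile contains \<open>y\<close>, so at most one term is
    nonzero.\<close>
  have le: "(\<Sum>n. ennreal \<bar>b n y\<bar>) \<le> ennreal \<bar>F y\<bar>" for y
  proof (cases "\<exists>n. y \<in> e n ` alcove")
    case True
    then obtain n where n: "y \<in> e n ` alcove" by blast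
    have "(\<Sum>n. ennreal \<bar>F y\<bar> * indicator (e n ` alcove) y) = ennreal \<bar>F y\<bar>"
      by (rule suminf_cmult_indicator[OF disj n])
    moreover have "ennreal \<bar>b n y\<bar> = ennreal \<bar>F y\<bar> * indicator (e n ` alcove) y" for n
      by (auto simp: b_def indicator_def)
    ultimately show ?thesis by simp
  next
    case False
    then have "b n y = 0" for n by (auto simp: b_def)
    then show ?thesis by simp
  qed
  have fin_F: "(\<integral>\<^sup>+ y. ennreal \<bar>F y\<bar> \<partial>lborel) < \<infinity>"
    using F by (simp add: integrable_iff_bounded)
  have "(\<Sum>n. \<integral>\<^sup>+ y. ennreal \<bar>b n y\<bar> \<partial>lborel) = (\<integral>\<^sup>+ y. (\<Sum>n. ennreal \<bar>b n y\<bar>) \<partial>lborel)"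
    by (rule nn_integral_suminf[symmetric]) simp
  also have "\<dots> \<le> (\<integral>\<^sup>+ y. ennreal \<bar>F y\<bar> \<partial>lborel)" by (rule nn_integral_mono) (rule le)
  finally have fin_b: "(\<Sum>n. \<integral>\<^sup>+ y. ennreal \<bar>b n y\<bar> \<partial>lborel) < \<infinity>" using fin_F by simp
  have "(\<integral>\<^sup>+ y. ennreal \<bar>a n y\<bar> \<partial>lborel) = (\<integral>\<^sup>+ y. ennreal \<bar>b n y\<bar> \<partial>distr lborel borel (e n))" for n
    by (subst nn_integral_distr) (simp_all add: ab)
  then have fin_a: "(\<Sum>n. \<integral>\<^sup>+ y. ennreal \<bar>a n y\<bar> \<partial>lborel) < \<infinity>"
    using fin_b by (simp add: lborel_distr_affine_weyl_group[OF eW])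
  have int_ab: "integral\<^sup>L lborel (a n) = integral\<^sup>L lborel (b n)" for n
  proof -
    have "integral\<^sup>L lborel (a n) = integral\<^sup>L (distr lborel borel (e n)) (b n)"
      by (subst integral_distr) (simp_all add: ab[abs_def])
    then show ?thesis by (simp add: lborel_distr_affine_weyl_group[OF eW])
  qed
  note a = suminf_nn_integral_finite[OF _ fin_a, simplified] and b = suminf_nn_integral_finite[OF _ fin_b, simplified]
  show ?thesis
  proof (rule that)
    show "(\<lambda>y. \<Sum>n. a n y) \<in> borel_measurable lborel" using a(3) by (rule borel_measurable_integrable)
    show "AE y in lborel. indicator alcove y *\<^sub>R (\<Sum>\<^sub>\<infinity>\<omega>\<in>affine_weyl_group. F (\<omega> y)) = (\<Sum>n. a n y)"
      using a(2)
    proof eventually_elim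
      fix y assume s: "summable (\<lambda>n. \<bar>a n y\<bar>)"
      show "indicator alcove y *\<^sub>R (\<Sum>\<^sub>\<infinity>\<omega>\<in>affine_weyl_group. F (\<omega> y)) = (\<Sum>n. a n y)"
      proof (cases "y \<in> alcove")
        case True
        \<comment> \<open>Absolute convergence makes the unordered sum independent of the chosen
          enumeration; almost every point has it.\<close>
        have "((\<lambda>n. a n y) has_sum (\<Sum>n. a n y)) UNIV"
          using s by (intro norm_summable_imp_has_sum summable_sums) (auto intro: summable_rabs_cancel)
        then have "(\<Sum>\<^sub>\<infinity>n\<in>UNIV. a n y) = (\<Sum>n. a n y)" by (rule infsumI)
        moreover have "(\<Sum>\<^sub>\<infinity>n\<in>UNIV. F (e n y)) = (\<Sum>\<^sub>\<infinity>\<omega>\<in>?W. F (\<omega> y))"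
          by (rule infsum_reindex_bij_betw[OF bij, of "\<lambda>\<omega>. F (\<omega> y)"])
        ultimately show ?thesis using True by (simp add: a_def)
      qed (simp add: a_def)
    qed
    have "AE y in lborel. \<forall>i j. i \<noteq> j \<longrightarrow> (y :: (real, 'k) vec) $ i - y $ j \<notin> \<int>"
    proof (intro AE_all_countable[THEN iffD2] allI)
      fix i j :: 'k
      show "AE y in lborel. i \<noteq> j \<longrightarrow> (y :: (real, 'k) vec) $ i - y $ j \<notin> \<int>"
      proof (cases "i = j")
        case False
        have "axis i 1 - axis j 1 \<noteq> (0 :: (real, 'k) vec)" using False by (simp add: axis_eq_axis)
        from AE_inner_not_int[OF this] show ?thesis
          by eventually_elim (simp add: inner_diff_left inner_axis')
      qed simp
    qed
    then have "AE y in lborel. (\<Sum>n. b n y) = F y"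
    proof eventually_elim
      fix y :: "(real, 'k) vec" assume "\<forall>i j. i \<noteq> j \<longrightarrow> y $ i - y $ j \<notin> \<int>"
      then obtain \<omega> where \<omega>: "\<omega> \<in> ?W" "y \<in> \<omega> ` alcove" using alcove_cover[of y] by blast
      from \<omega>(1) obtain n where "\<omega> = e n" using bij by (metis bij_betw_imp_surj_on imageE)
      with \<omega>(2) have n: "y \<in> e n ` alcove" by simp
      have "b m y = 0" if "m \<notin> {n}" for m
        using disj n that by (auto simp: b_def disjoint_family_on_def indicator_def)
      then have "(\<Sum>n. b n y) = (\<Sum>m\<in>{n}. b m y)" by (intro suminf_finite) auto
      then show "(\<Sum>n. b n y) = F y" using n by (simp add: b_def)
    qed
    then have "(LINT y|lborel. (\<Sum>n. b n y)) = integral\<^sup>L lborel F"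
      using b(3) F by (intro integral_cong_AE) auto
    then show "(LINT y|lborel. (\<Sum>n. a n y)) = integral\<^sup>L lborel F"
      unfolding a(4) b(4) int_ab .
  qed
qed

section \<open>Both sides as the integral of the signed product over the whole space\<close>

theorem proposition16:
  fixes f :: "'k::{finite,linorder} \<Rightarrow> real \<Rightarrow> real"
  assumes "CARD('k) \<ge> 3" and "odd CARD('k)"
    and "\<And>i. integrable lebesgue (f i)"
    and "\<And>i j. i \<noteq> j \<Longrightarrow>
      (\<Sum>m. \<integral>\<^sup>+ (y, z)\<in>far_apart (Suc m). ennreal \<bar>f i y * f j z\<bar> \<partial>lebesgue) < \<infinity>"
  shows "(LINT y:alcove|lebesgue.
            (\<Sum>\<^sub>\<infinity>\<omega>\<in>affine_weyl_group. weyl_sign \<omega> * (\<Prod>i\<in>UNIV. f i (\<omega> y $ i)))) =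
         (\<Sum>l\<in>UNIV. (-1) ^ (index_pos l + 1) * (LINT x|lebesgue. f l x) *
            pfaffian (UNIV - {l}) (\<lambda>i j. H_entry (f i) (f j)))"
proof -
  have "\<exists>g\<in>borel_measurable lborel. AE x in lborel. f i x = g x" for i
    using assms(3)[of i] by (intro completion_ex_borel_measurable_real) auto
  then obtain g where g_meas: "\<And>i. g i \<in> borel_measurable lborel" and fg: "\<And>i. AE x in lborel. f i x = g i x"
    by metis
  have int_fg: "(LINT x|lebesgue. f i x) = (LINT x|lborel. g i x)" for i
    by (rule lebesgue_integral_AE_eq[OF g_meas fg])
  have g: "integrable lborel (g i)" for i
  proof -
    have "integrable lebesgue (g i)"
      using assms(3)[of i] fg[of i] g_meas[of i]
      by (subst integrable_cong_AE[of _ _ "f i"]) (auto simp: AE_completion_iff measurable_completion)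
    then show ?thesis using g_meas[of i] by (simp add: integrable_completion)
  qed
  note H = H_entry_eq[OF fg fg g g assms(4)]
  define F where "F y = alcove_sign (($) y) * (\<Prod>i\<in>UNIV. g i (y $ i))" for y :: "(real, 'k) vec"
  define t where "t l \<pi> y = (\<Prod>B\<in>\<pi>. floor_ceil (y $ Min B - y $ Max B)) * (\<Prod>i\<in>UNIV. g i (y $ i))"
    for l :: 'k and \<pi> and y :: "(real, 'k) vec"
  have F_eq: "F y = (\<Sum>l\<in>UNIV. \<Sum>\<pi>\<in>pair_partitions (UNIV - {l}). (-1) ^ (index_pos l + 1) * (-1) ^ crossings \<pi> * t l \<pi> y)" for y
    by (simp add: F_def alcove_sign_eq_pfaffian pfaffian_def t_def sum_distrib_left sum_distrib_right mult_ac)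
  have t: "integrable lborel (t l \<pi>)"
    "integral\<^sup>L lborel (t l \<pi>) = (LINT x|lebesgue. f l x) * (\<Prod>B\<in>\<pi>. H_entry (f (Min B)) (f (Max B)))"
    if \<pi>: "\<pi> \<in> pair_partitions (UNIV - {l})" for l \<pi>
  proof -
    show "integrable lborel (t l \<pi>)"
      unfolding t_def[abs_def] by (rule integral_pair_partition(1)[OF g \<pi> H(1)])
    have H_prod: "(\<Prod>B\<in>\<pi>. H_entry (f (Min B)) (f (Max B))) = (\<Prod>B\<in>\<pi>. LINT (y, z)|lborel. floor_ceil (y - z) * g (Min B) y * g (Max B) z)"
    proof (rule prod.cong[OF refl])
      fix B assume "B \<in> \<pi>"
      then have "Min B \<noteq> Max B"
        using card_2_MinMax(2)[OF pair_partitionsD(2)[OF \<pi>]] by fastforce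
      then show "H_entry (f (Min B)) (f (Max B)) = (LINT (y, z)|lborel. floor_ceil (y - z) * g (Min B) y * g (Max B) z)"
        by (rule H(2))
    qed
    show "integral\<^sup>L lborel (t l \<pi>) = (LINT x|lebesgue. f l x) * (\<Prod>B\<in>\<pi>. H_entry (f (Min B)) (f (Max B)))"
      unfolding t_def[abs_def] int_fg H_prod by (rule integral_pair_partition(2)[OF g \<pi> H(1)])
  qed
  \<comment> \<open>Obtained from the finite expansion, each summand being integrable by
    \<open>t\<close>.\<close>
  have F: "integrable lborel F"
    unfolding F_eq[abs_def] using t(1) by (intro Bochner_Integration.integrable_sum integrable_mult_right) auto
  have int_F: "integral\<^sup>L lborel F = (\<Sum>l\<in>UNIV. (-1) ^ (index_pos l + 1) * (LINT x|lebesgue. f l x) *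
            pfaffian (UNIV - {l}) (\<lambda>i j. H_entry (f i) (f j)))"
    unfolding F_eq[abs_def] using t
    by (simp add: Bochner_Integration.integral_sum pfaffian_def sum_distrib_left mult_ac)
  have "2 \<le> CARD('k)" using assms(1) by simp
  then obtain S where S: "S \<in> borel_measurable lborel"
    "AE y in lborel. indicator alcove y *\<^sub>R (\<Sum>\<^sub>\<infinity>\<omega>\<in>affine_weyl_group. F (\<omega> y)) = S y"
    "integral\<^sup>L lborel S = integral\<^sup>L lborel F"
    using alcove_tiling[OF _ F] by blast
  \<comment> \<open>Each \<omega> preserves Lebesgue measure and so pulls null sets back to null
    sets; as the group is countable, one null set serves all its elements.\<close>
  have "AE y in lborel. \<forall>\<omega>\<in>affine_weyl_group. \<forall>i. f i (\<omega> (y :: (real, 'k) vec) $ i) = g i (\<omega> y $ i)"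
  proof (rule AE_ball_countable'[OF _ countable_affine_weyl_group])
    fix \<omega> :: "(real, 'k) vec \<Rightarrow> (real, 'k) vec" assume \<omega>: "\<omega> \<in> affine_weyl_group"
    have "AE y in distr lborel borel \<omega>. \<forall>i. f i (y $ i) = g i (y $ i)"
      unfolding lborel_distr_affine_weyl_group[OF \<omega>] AE_all_countable using AE_lborel_nth[OF fg] by blast
    then show "AE y in lborel. \<forall>i. f i (\<omega> y $ i) = g i (\<omega> y $ i)"
      by (rule AE_distrD[rotated]) (simp add: borel_measurable_affine_weyl_group[OF \<omega>])
  qed
  with S(2) have "AE y in lborel. indicator alcove y *\<^sub>R
     (\<Sum>\<^sub>\<infinity>\<omega>\<in>affine_weyl_group. weyl_sign \<omega> * (\<Prod>i\<in>UNIV. f i (\<omega> y $ i))) = S y"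
  proof eventually_elim
    fix y :: "(real, 'k) vec"
    assume S: "indicator alcove y *\<^sub>R (\<Sum>\<^sub>\<infinity>\<omega>\<in>affine_weyl_group. F (\<omega> y)) = S y"
      and fg: "\<forall>\<omega>\<in>affine_weyl_group. \<forall>i. f i (\<omega> y $ i) = g i (\<omega> y $ i)"
    \<comment> \<open>For \<open>y\<close> in the alcove the sign of \<omega> is the value of
      \<open>alcove_sign\<close> at the image point, so each summand is \<open>F\<close> evaluated
      there.\<close>
    have "(\<Sum>\<^sub>\<infinity>\<omega>\<in>affine_weyl_group. weyl_sign \<omega> * (\<Prod>i\<in>UNIV. f i (\<omega> y $ i))) =
      (\<Sum>\<^sub>\<infinity>\<omega>\<in>affine_weyl_group. F (\<omega> y))" if "y \<in> alcove"
      using fg by (intro infsum_cong) (simp add: F_def alcove_sign_affine_weyl_group[OF _ that assms(2)])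
    then show "indicator alcove y *\<^sub>R
     (\<Sum>\<^sub>\<infinity>\<omega>\<in>affine_weyl_group. weyl_sign \<omega> * (\<Prod>i\<in>UNIV. f i (\<omega> y $ i))) = S y"
      using S by (cases "y \<in> alcove") auto
  qed
  then show ?thesis
    unfolding set_lebesgue_integral_def int_F[symmetric] S(3)[symmetric]
    by (rule lebesgue_integral_AE_eq[OF S(1)])
qed

end
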